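(* Every earth-moon graph is $9$-choosable with clustering $2$, and is $8$-choosable with clustering $405$.
   Context: Graphs are finite and simple. An earth-moon (biplanar) graph is a graph that is the union of two planar graphs (on the same vertex set). In a coloured graph the monochromatic subgraph is the spanning subgraph of edges whose endpoints have the same colour; its connected components are monochromatic components. A colouring has clustering $c$ if every monochromatic component has at most $c$ vertices. A $k$-list-assignment $L$ assigns to each vertex $v$ a set $L(v)$ of at least $k$ colours; an $L$-colouring colours each $v$ with a colour from $L(v)$. $G$ is $k$-choosable with clustering $c$ if for every $k$-list-assignment $L$, $G$ has an $L$-colouring with clustering $c$. *)

theory Defs
  imports
    "HOL-Analysis.Analysis"
    "Graph_Theory.Digraph_Component"
    "Graph_Theory.Pair_Digraph"
begin

text \<open>
  A finite simple graph is a \<^term>\<open>pair_graph\<close>: a finite vertex set together with a symmetric,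
  irreflexive set of ordered pairs, so that the edge joining \<open>u\<close> and \<open>v\<close> is represented by both
  \<open>(u, v)\<close> and \<open>(v, u)\<close>. In such a graph strongly connected components are the usual connected
  components.
\<close>

text \<open>
  \<^typ>\<open>complex\<close> serves as the Euclidean plane, as in the library's Jordan curve theorem. The map
  \<open>p\<close> gives the positions of the vertices, and \<open>D {u, v}\<close> is the point set of the curve that
  draws the edge joining \<open>u\<close> and \<open>v\<close>; being indexed by the unordered pair, it is the same for
  both orientations. The last two conditions say that no edge passes through a further vertex and
  that distinct edges meet only in common endpoints.
\<close>

definition plane_drawing ::
    "'a pair_pre_digraph \<Rightarrow> ('a \<Rightarrow> complex) \<Rightarrow> ('a set \<Rightarrow> complex set) \<Rightarrow> bool" where
  "plane_drawing G p D \<longleftrightarrow>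
     inj_on p (pverts G) \<and>
     (\<forall>(u, v) \<in> parcs G.
        \<exists>g. arc g \<and> pathstart g = p u \<and> pathfinish g = p v \<and> path_image g = D {u, v}) \<and>
     (\<forall>(u, v) \<in> parcs G. D {u, v} \<inter> p ` pverts G \<subseteq> {p u, p v}) \<and>
     (\<forall>(u, v) \<in> parcs G. \<forall>(x, y) \<in> parcs G.
        {u, v} \<noteq> {x, y} \<longrightarrow> D {u, v} \<inter> D {x, y} \<subseteq> p ` ({u, v} \<inter> {x, y}))"

definition planar_graph :: "'a pair_pre_digraph \<Rightarrow> bool" where
  "planar_graph G \<longleftrightarrow> pair_graph G \<and> (\<exists>p D. plane_drawing G p D)"

definition earth_moon_graph :: "'a pair_pre_digraph \<Rightarrow> bool" where
  "earth_moon_graph G \<longleftrightarrow>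
     pair_graph G \<and>
     (\<exists>G1 G2. planar_graph G1 \<and> planar_graph G2 \<and>
        pverts G1 = pverts G \<and> pverts G2 = pverts G \<and>
        parcs G = parcs G1 \<union> parcs G2)"

definition monochromatic_subgraph ::
    "'a pair_pre_digraph \<Rightarrow> ('a \<Rightarrow> 'c) \<Rightarrow> 'a pair_pre_digraph" where
  "monochromatic_subgraph G f =
     \<lparr> pverts = pverts G, parcs = {(u, v) \<in> parcs G. f u = f v} \<rparr>"

definition monochromatic_components ::
    "'a pair_pre_digraph \<Rightarrow> ('a \<Rightarrow> 'c) \<Rightarrow> ('a, 'a \<times> 'a) pre_digraph set" where
  "monochromatic_components G f = pre_digraph.sccs (with_proj (monochromatic_subgraph G f))"

definition has_clustering :: "'a pair_pre_digraph \<Rightarrow> ('a \<Rightarrow> 'c) \<Rightarrow> nat \<Rightarrow> bool" where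
  "has_clustering G f c \<longleftrightarrow> (\<forall>K \<in> monochromatic_components G f. card (verts K) \<le> c)"

text \<open>
  Lists may be infinite; the first disjunct is needed because \<^const>\<open>card\<close> of an infinite set
  is \<open>0\<close>.
\<close>

definition list_assignment ::
    "nat \<Rightarrow> 'a pair_pre_digraph \<Rightarrow> ('a \<Rightarrow> 'c set) \<Rightarrow> bool" where
  "list_assignment k G L \<longleftrightarrow> (\<forall>v \<in> pverts G. infinite (L v) \<or> k \<le> card (L v))"

definition list_colouring ::
    "'a pair_pre_digraph \<Rightarrow> ('a \<Rightarrow> 'c set) \<Rightarrow> ('a \<Rightarrow> 'c) \<Rightarrow> bool" where
  "list_colouring G L f \<longleftrightarrow> (\<forall>v \<in> pverts G. f v \<in> L v)"

text \<open>
  The colours are drawn from the type \<open>'c\<close>, passed as an explicit argument because a definition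
  cannot quantify over types; a statement with \<open>'c\<close> free covers all colour sets.
\<close>

definition choosable_with_clustering ::
    "'c itself \<Rightarrow> 'a pair_pre_digraph \<Rightarrow> nat \<Rightarrow> nat \<Rightarrow> bool" where
  "choosable_with_clustering _ G k c \<longleftrightarrow>
     (\<forall>L :: 'a \<Rightarrow> 'c set. list_assignment k G L \<longrightarrow>
        (\<exists>f. list_colouring G L f \<and> has_clustering G f c))"

end

theory Submission
  imports Defs
begin

text \<open>
  A plane graph has fewer than three times as many edges as vertices, so an induced subgraph of an
  earth-moon graph has average degree less than 12. Take a maximal set \<open>B\<close> of vertices whose
  degrees satisfy a suitable weighted bound, and colour \<open>B\<close> inductively. Every nonempty subset of
  the remaining set \<open>A\<close> violates the bound, which means that in \<open>A\<close> the lists of colours not used by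
  neighbours in \<open>B\<close> are large compared with the degrees. A colouring of \<open>A\<close> with the fewest
  monochromatic edges then has monochromatic degree at most 1 for lists of size 9.

  For lists of size 8 the monochromatic degree is at most 2, so the components are paths and cycles.
  Many interior vertices of a long component can be switched to another colour without
  creating monochromatic edges. Cut the long components into blocks and switch one vertex in each
  block. Haxell's theorem on independent transversals provides a choice for which a switched vertex
  joins only two old components, which no other switched vertex joins to further ones.
\<close>

text \<open>In the weighted bound, \<open>a\<close> times the sum over \<open>B\<close> of degree
  minus \<open>k\<close> is at least twice the number of edges meeting \<open>B\<close>, where
  \<open>k\<close> is the list size. The whole vertex set violates it when the average degree is
  less than \<open>a * k / (a - 1)\<close>; this is 12 both for \<open>a = 4\<close>,
  \<open>k = 9\<close> and for \<open>a = 3\<close>, \<open>k = 8\<close>. For a single vertex of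
  \<open>A\<close> violation means that the degree is less than \<open>a / (a - 2)\<close> times the
  size of the remaining list, that is 2 or 3 times. A colour that is rarest among the neighbours
  then occurs at most once or at most twice. For lists of size 8, violation by a whole block gives
  almost as many switches as the block has vertices. A switch keeps the number of monochromatic
  edges, so the colouring stays optimal and its monochromatic degrees stay at most 2. This is why a
  switched vertex can attach only to ends of old components. The obstacle is a chain of such
  attachments. A switch has at most \<open>19 + 2 * 23 = 65\<close> others that could start a chain
  with it, and \<open>2 * 65\<close> switches per block suffice to avoid them all.\<close>

hide_const (open) Digraph_Component.connected

subsection \<open>Edges of plane graphs\<close>

text \<open>Edges are two-element sets instead of pairs of arcs, so that deleting an edge removes
  one element of \<open>E\<close> while \<open>p\<close> and \<open>D\<close> stay fixed; the
  inductions on edges rely on this.\<close>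

definition drawn :: "'a set \<Rightarrow> 'a set set \<Rightarrow> ('a \<Rightarrow> complex) \<Rightarrow> ('a set \<Rightarrow> complex set) \<Rightarrow> bool" where
  "drawn V E p D \<longleftrightarrow> finite V \<and> inj_on p V \<and>
     (\<forall>e\<in>E. \<exists>u v g. e = {u, v} \<and> u \<noteq> v \<and> u \<in> V \<and> v \<in> V \<and>
        arc g \<and> pathstart g = p u \<and> pathfinish g = p v \<and> path_image g = D e) \<and>
     (\<forall>e\<in>E. D e \<inter> p ` V \<subseteq> p ` e) \<and>
     (\<forall>e\<in>E. \<forall>e'\<in>E. e \<noteq> e' \<longrightarrow> D e \<inter> D e' \<subseteq> p ` (e \<inter> e'))"

definition picture :: "'a set \<Rightarrow> 'a set set \<Rightarrow> ('a \<Rightarrow> complex) \<Rightarrow> ('a set \<Rightarrow> complex set) \<Rightarrow> complex set" where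
  "picture V E p D = p ` V \<union> \<Union> (D ` E)"

definition edge_rel :: "'a set set \<Rightarrow> ('a \<times> 'a) set" where
  "edge_rel E = {(u, v). {u, v} \<in> E}"

text \<open>Endpoints are excluded because the frontier of a face may contain an endpoint of an edge
  along which the face does not run.\<close>

definition touches :: "('a \<Rightarrow> complex) \<Rightarrow> ('a set \<Rightarrow> complex set) \<Rightarrow> complex set \<Rightarrow> 'a set \<Rightarrow> bool" where
  "touches p D f e \<longleftrightarrow> frontier f \<inter> (D e - p ` e) \<noteq> {}"

lemma drawn_inj: "drawn V E p D \<Longrightarrow> inj_on p V"
  by (simp add: drawn_def)

lemma drawn_inter:
  assumes "drawn V E p D" "e \<in> E"
  shows "D e \<inter> p ` V \<subseteq> p ` e" "e' \<in> E \<Longrightarrow> e \<noteq> e' \<Longrightarrow> D e \<inter> D e' \<subseteq> p ` (e \<inter> e')"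
  using assms unfolding drawn_def by simp_all

lemma drawn_edgeE:
  assumes "drawn V E p D" "e \<in> E"
  obtains u v g where "e = {u, v}" "u \<noteq> v" "u \<in> V" "v \<in> V"
    "arc g" "pathstart g = p u" "pathfinish g = p v" "path_image g = D e"
proof -
  have "\<exists>u v g. e = {u, v} \<and> u \<noteq> v \<and> u \<in> V \<and> v \<in> V \<and>
        arc g \<and> pathstart g = p u \<and> pathfinish g = p v \<and> path_image g = D e"
    using assms by (simp add: drawn_def)
  then show ?thesis using that by blast
qed

lemma drawn_mono:
  assumes "drawn V E p D" "W \<subseteq> V" "F \<subseteq> E" "\<And>e. e \<in> F \<Longrightarrow> e \<subseteq> W"
  shows "drawn W F p D"
  unfolding drawn_def
proof (intro conjI ballI impI)
  show "finite W" "inj_on p W"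
    using assms(1,2) by (auto simp: drawn_def finite_subset inj_on_subset)
next
  fix e assume e: "e \<in> F"
  then have "e \<in> E" using assms(3) by blast
  then obtain u v g where "e = {u, v} \<and> u \<noteq> v \<and> u \<in> V \<and> v \<in> V \<and>
        arc g \<and> pathstart g = p u \<and> pathfinish g = p v \<and> path_image g = D e"
    using drawn_edgeE[OF assms(1)] by metis
  then show "\<exists>u v g. e = {u, v} \<and> u \<noteq> v \<and> u \<in> W \<and> v \<in> W \<and>
        arc g \<and> pathstart g = p u \<and> pathfinish g = p v \<and> path_image g = D e"
    using assms(4)[OF e] by blast
  show "D e \<inter> p ` W \<subseteq> p ` e"
  proof -
    have "D e \<inter> p ` V \<subseteq> p ` e" using drawn_inter(1)[OF assms(1)] assms(3) e by blast
    then show ?thesis using assms(2) by blast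
  qed
next
  fix e e' assume "e \<in> F" "e' \<in> F" "e \<noteq> e'"
  then show "D e \<inter> D e' \<subseteq> p ` (e \<inter> e')"
    using drawn_inter(2)[OF assms(1)] assms(3) by blast
qed

lemma drawn_finite:
  assumes "drawn V E p D"
  shows "finite V" "finite E"
proof -
  show V: "finite V" using assms by (simp add: drawn_def)
  have "E \<subseteq> Pow V" using assms by (auto elim!: drawn_edgeE)
  then show "finite E" using V by (simp add: finite_subset)
qed

lemma drawn_edge_facts:
  assumes "drawn V E p D" "e \<in> E"
  shows "compact (D e)" "connected (- D e)" "connected (D e - p ` e)" "D e - p ` e \<noteq> {}"
    "p ` e \<subseteq> D e" "card e = 2" "e \<subseteq> V"
proof -
  obtain u v g where g: "e = {u, v}" "u \<noteq> v" "u \<in> V" "v \<in> V"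
    "arc g" "pathstart g = p u" "pathfinish g = p v" "path_image g = D e"
    using assms by (rule drawn_edgeE)
  show "compact (D e)" using g(5,8) by (metis compact_arc_image)
  show "connected (- D e)" using g(5,8) connected_arc_complement[of g] by simp
  show "connected (D e - p ` e)" "D e - p ` e \<noteq> {}"
    using g connected_simple_path_endless[of g] nonempty_simple_path_endless[of g]
    by (simp_all add: arc_imp_simple_path)
  show "p ` e \<subseteq> D e" using g pathstart_in_path_image[of g] pathfinish_in_path_image[of g] by auto
  show "card e = 2" "e \<subseteq> V" using g by auto
qed

lemma picture_compact:
  assumes "drawn V E p D"
  shows "compact (picture V E p D)"
proof -
  have "compact (p ` V)" using drawn_finite(1)[OF assms] by (simp add: finite_imp_compact)
  moreover have "compact (\<Union> (D ` E))"
    using drawn_finite(2)[OF assms] drawn_edge_facts(1)[OF assms] by (intro compact_UN) auto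
  ultimately show ?thesis unfolding picture_def by (rule compact_Un)
qed

lemma picture_insert_edge: "e \<in> E \<Longrightarrow> picture V E p D = picture V (E - {e}) p D \<union> D e"
  unfolding picture_def by auto

lemma edge_inter_picture:
  assumes "drawn V E p D" "e \<in> E" "F \<subseteq> E" "e \<notin> F"
  shows "D e \<inter> picture V F p D = p ` e"
proof
  show "D e \<inter> picture V F p D \<subseteq> p ` e"
  proof
    fix x assume x: "x \<in> D e \<inter> picture V F p D"
    show "x \<in> p ` e"
    proof (cases "x \<in> p ` V")
      case True then show ?thesis using drawn_inter(1)[OF assms(1,2)] x by blast
    next
      case False
      then obtain e' where "e' \<in> F" "x \<in> D e'" using x unfolding picture_def by blast
      then have "D e \<inter> D e' \<subseteq> p ` (e \<inter> e')" using drawn_inter(2)[OF assms(1,2), of e'] assms(3,4) by blast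
      then show ?thesis using x \<open>x \<in> D e'\<close> by blast
    qed
  qed
  show "p ` e \<subseteq> D e \<inter> picture V F p D"
    using drawn_edge_facts(5,7)[OF assms(1,2)] unfolding picture_def by blast
qed

section \<open>Faces on the two sides of an edge\<close>

lemma reach_imp_path_component:
  assumes "drawn V E p D" "u \<in> V" "(u, v) \<in> (edge_rel E)\<^sup>*"
  shows "path_component (picture V E p D) (p u) (p v)"
  using assms(3)
proof (induction rule: rtrancl_induct)
  case base
  have "p u \<in> picture V E p D" using assms(2) by (simp add: picture_def)
  then show ?case by (simp add: path_component_refl)
next
  case (step v w)
  have e: "{v, w} \<in> E" using step(2) by (simp add: edge_rel_def)
  obtain u' v' g where g: "{v, w} = {u', v'}"
    "arc g" "pathstart g = p u'" "pathfinish g = p v'" "path_image g = D {v, w}"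
    using drawn_edgeE[OF assms(1) e] by metis
  have "path_image g \<subseteq> picture V E p D" using g e unfolding picture_def by blast
  then have "path_component (picture V E p D) (p u') (p v')"
    unfolding path_component_def using g arc_imp_path by blast
  then have "path_component (picture V E p D) (p v) (p w)"
    using g(1) path_component_sym by (metis doubleton_eq_iff)
  then show ?case using step.IH path_component_trans by blast
qed

text \<open>A path between the ends of the edge in the rest of the picture can be shortened to an
  arc, which the edge closes up. The curve meets the rest of the picture in this arc alone; the last
  conclusion records the connectedness that Janiszewski's theorem asks for.\<close>

lemma Jordan_curve_through_edge:
  assumes d: "drawn V E p D" and e: "{u, v} \<in> E" "u \<noteq> v"
    and r: "(u, v) \<in> (edge_rel (E - {{u, v}}))\<^sup>*"
  obtains c where "simple_path c" "pathfinish c = pathstart c"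
    "D {u, v} \<subseteq> path_image c" "path_image c \<subseteq> picture V E p D"
    "connected (path_image c \<inter> picture V (E - {{u, v}}) p D)"
proof -
  let ?X = "picture V (E - {{u, v}}) p D"
  obtain u' v' g where g: "{u, v} = {u', v'}" "u' \<in> V" "v' \<in> V" "arc g"
    "pathstart g = p u'" "pathfinish g = p v'" "path_image g = D {u, v}"
    using drawn_edgeE[OF d e(1)] by metis
  have d': "drawn V (E - {{u, v}}) p D"
    using d drawn_edge_facts(7)[OF d] by (auto intro: drawn_mono)
  have uV: "u \<in> V" "v \<in> V" using drawn_edge_facts(7)[OF d e(1)] by auto
  have puv: "p u \<noteq> p v" using drawn_inj[OF d] e(2) uV by (auto simp: inj_on_def)
  have "path_component ?X (p u) (p v)"
    using reach_imp_path_component[OF d' uV(1) r] .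
  then have "path_component ?X (p v') (p u')"
    using g(1) path_component_sym by (metis doubleton_eq_iff)
  then obtain q where q: "path q" "path_image q \<subseteq> ?X" "pathstart q = p v'" "pathfinish q = p u'"
    unfolding path_component_def by blast
  have neq: "p v' \<noteq> p u'" using puv g(1) by (auto simp: doubleton_eq_iff)
  obtain h where h: "arc h" "path_image h \<subseteq> path_image q" "pathstart h = p v'" "pathfinish h = p u'"
    by (rule path_contains_arc[OF q(1,3,4) neq])
  then have hX: "path_image h \<subseteq> ?X" using q(2) by blast
  have De: "D {u, v} \<inter> ?X = {p u', p v'}"
  proof -
    have "p ` {u, v} = {p u', p v'}" unfolding g(1) by simp
    then show ?thesis using edge_inter_picture[OF d e(1), of "E - {{u, v}}"] by simp
  qed
  define c where "c = g +++ h"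
  have pc: "path_image c = D {u, v} \<union> path_image h"
    unfolding c_def using g h by (simp add: path_image_join)
  have "simple_path c" unfolding c_def
    by (rule simple_path_join_loop) (use g(4-7) h hX De in \<open>simp_all, blast\<close>)
  moreover have "pathfinish c = pathstart c" unfolding c_def using g h by simp
  moreover have "path_image c \<inter> ?X = path_image h"
  proof -
    have "{p u', p v'} \<subseteq> path_image h"
      using h(3,4) pathstart_in_path_image[of h] pathfinish_in_path_image[of h] by simp
    then show ?thesis using pc De hX by blast
  qed
  ultimately show ?thesis
    using that[of c] pc hX connected_arc_image[OF h(1)] picture_insert_edge[OF e(1), of V p D] by simp blast
qed

text \<open>Adding a frontier point to a face keeps it connected, and the edge without its ends is
  connected, so all faces that touch \<open>e\<close> merge when \<open>e\<close> is erased.\<close>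

lemma touching_faces_connected:
  assumes d: "drawn V E p D" and e: "e \<in> E"
    and "f \<in> components (- picture V E p D)" "f' \<in> components (- picture V E p D)"
    and "touches p D f e" "touches p D f' e" "a \<in> f" "b \<in> f'"
  shows "connected_component (- picture V (E - {e}) p D) a b"
proof -
  let ?I = "D e - p ` e" and ?X' = "picture V (E - {e}) p D"
  have De: "D e \<inter> ?X' = p ` e"
    by (rule edge_inter_picture[OF d e]) auto
  have X: "picture V E p D = ?X' \<union> D e" by (rule picture_insert_edge[OF e])
  have fI: "connected (f \<union> ?I) \<and> f \<union> ?I \<subseteq> - ?X'"
    if f: "f \<in> components (- picture V E p D)" "touches p D f e" for f
  proof
    obtain z where z: "z \<in> frontier f" "z \<in> ?I" using f(2) unfolding touches_def by blast
    have "connected (insert z f)"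
      by (rule connected_intermediate_closure[OF in_components_connected[OF f(1)]])
        (use z closure_subset in \<open>auto simp: frontier_def\<close>)
    then have "connected (insert z f \<union> ?I)"
      using z drawn_edge_facts(3)[OF d e] by (intro connected_Un) auto
    then show "connected (f \<union> ?I)" using z by (simp add: insert_absorb)
    show "f \<union> ?I \<subseteq> - ?X'" using in_components_subset[OF f(1)] X De by auto
  qed
  have "connected ((f \<union> ?I) \<union> (f' \<union> ?I))"
    using fI[of f] fI[of f'] assms(3-6) drawn_edge_facts(4)[OF d e] connected_Un[of "f \<union> ?I" "f' \<union> ?I"] by blast
  then show ?thesis unfolding connected_component_def
    using fI assms by (intro exI[of _ "(f \<union> ?I) \<union> (f' \<union> ?I)"]) auto
qed

lemma components_eqI:
  assumes "f \<in> components S" "f' \<in> components S" "a \<in> f" "b \<in> f'" "connected_component S a b"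
  shows "f = f'"
proof -
  obtain x y where "f = connected_component_set S x" "f' = connected_component_set S y"
    using assms(1,2) by (auto simp: components_def)
  then have "f = connected_component_set S a" "f' = connected_component_set S b"
    using assms(3,4) connected_component_eq by blast+
  then show ?thesis using assms(5) connected_component_eq_eq by (metis connected_component_in)
qed

text \<open>If \<open>e\<close> lies on a cycle, Janiszewski's theorem for the Jordan curve through \<open>e\<close> and the
  picture without \<open>e\<close>, which meet in an arc, leaves one face inside and one outside.
  If not, \<open>e\<close> is attached to each of the two parts in a single point.\<close>

lemma ex_subset_singleton: "(\<And>x y. x \<in> A \<Longrightarrow> y \<in> A \<Longrightarrow> x = y) \<Longrightarrow> \<exists>z. A \<subseteq> {z}"
  by blast

lemma card_touching_faces:
  assumes d: "drawn V E p D" and e: "e \<in> E"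
  shows "finite {f \<in> components (- picture V E p D). touches p D f e} \<and>
         card {f \<in> components (- picture V E p D). touches p D f e} \<le> 2" (is "finite ?T \<and> _")
proof -
  let ?X = "picture V E p D" and ?X' = "picture V (E - {e}) p D"
  obtain u v where uv: "e = {u, v}" "u \<noteq> v" "u \<in> V" "v \<in> V"
    using drawn_edgeE[OF d e] by metis
  have d': "drawn V (E - {e}) p D"
    using d drawn_edge_facts(7)[OF d] by (auto intro: drawn_mono)
  have cX': "compact ?X'" by (rule picture_compact[OF d'])
  have X: "?X = ?X' \<union> D e" by (rule picture_insert_edge[OF e])
  have De: "D e \<inter> ?X' = p ` e" by (rule edge_inter_picture[OF d e]) auto
  have conn: "connected_component (- ?X') a b" if "f \<in> ?T" "f' \<in> ?T" "a \<in> f" "b \<in> f'" for f f' a b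
    using touching_faces_connected[OF d e] that by blast
  have sub: "f \<subseteq> - ?X" "connected f" "f \<noteq> {}" if "f \<in> ?T" for f
    using that in_components_subset in_components_connected in_components_nonempty by blast+
  show ?thesis
  proof (cases "(u, v) \<in> (edge_rel (E - {e}))\<^sup>*")
    case True
    then obtain c where c: "simple_path c" "pathfinish c = pathstart c"
      "D e \<subseteq> path_image c" "path_image c \<subseteq> ?X" "connected (path_image c \<inter> ?X')"
      using Jordan_curve_through_edge[OF d, of u v] e uv by blast
    note J = Jordan_inside_outside[OF c(1,2)]
    have JU: "inside (path_image c) \<union> outside (path_image c) = - path_image c" using J by (elim conjE)
    have JS: "inside (path_image c) \<subseteq> - path_image c" "outside (path_image c) \<subseteq> - path_image c"
      using JU by blast+
    have JC: "connected (inside (path_image c))" "connected (outside (path_image c))" using J by simp_all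
    have XC: "?X = path_image c \<union> ?X'" using X c by auto
    \<comment> \<open>\<open>S\<close> will be the inside or the outside of the curve. It joins
      \<open>a\<close> and \<open>b\<close> off the curve, \<open>conn\<close> joins them off
      \<open>?X'\<close>, and these two sets make up the picture.\<close>
    have eq: "f = f'" if f: "f \<in> ?T" "f' \<in> ?T" and i: "f \<inter> S \<noteq> {}" "f' \<inter> S \<noteq> {}"
      and S: "connected S" "S \<subseteq> - path_image c" for f f' S
    proof -
      obtain a b where ab: "a \<in> f" "b \<in> f'" "a \<in> S" "b \<in> S" using i by blast
      have "connected_component (- (path_image c \<union> ?X')) a b"
        by (rule Janiszewski)
          (use ab S c conn[OF f ab(1,2)] cX' compact_simple_path_image compact_imp_closed in
            \<open>auto simp: connected_component_def\<close>)
      then show ?thesis using components_eqI[of f "- ?X" f' a b] ab f by (simp flip: XC)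
    qed
    let ?Ti = "{f \<in> ?T. f \<inter> inside (path_image c) \<noteq> {}}"
    let ?To = "{f \<in> ?T. f \<inter> outside (path_image c) \<noteq> {}}"
    have io: "f \<in> ?Ti \<union> ?To" if "f \<in> ?T" for f
    proof -
      have "f \<subseteq> inside (path_image c) \<union> outside (path_image c)"
        using sub(1)[OF that] c(4) JU by blast
      then show ?thesis using sub(3)[OF that] that by blast
    qed
    have "f = f'" if "f \<in> ?Ti" "f' \<in> ?Ti" for f f'
      by (rule eq[where S="inside (path_image c)"]) (use that JS JC in auto)
    then have "\<exists>x. ?Ti \<subseteq> {x}" by (rule ex_subset_singleton)
    then obtain x where x: "?Ti \<subseteq> {x}" ..
    have "f = f'" if "f \<in> ?To" "f' \<in> ?To" for f f'
      by (rule eq[where S="outside (path_image c)"]) (use that JS JC in auto)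
    then have "\<exists>x. ?To \<subseteq> {x}" by (rule ex_subset_singleton)
    then obtain y where y: "?To \<subseteq> {y}" ..
    have "?T \<subseteq> {x, y}"
    proof
      fix f assume "f \<in> ?T"
      then show "f \<in> {x, y}" using io[of f] x y by blast
    qed
    moreover have "card {x, y} \<le> 2" by (simp add: card_insert_if)
    ultimately show ?thesis
      by (meson card_mono finite.intros finite_subset le_trans)
  next
    case False
    \<comment> \<open>No edge other than \<open>e\<close> leaves the part reachable from
      \<open>u\<close>, so the rest of the picture falls into disjoint compact sets
      \<open>X1\<close> and \<open>X2\<close>, each meeting the arc in one endpoint.\<close>
    define A where "A = (edge_rel (E - {e}))\<^sup>* `` {u} \<inter> V"
    define X1 where "X1 = picture A {e'\<in>E - {e}. e' \<subseteq> A} p D"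
    define X2 where "X2 = picture (V - A) {e'\<in>E - {e}. e' \<subseteq> V - A} p D"
    have uA: "u \<in> A" "v \<notin> A" using False uv by (auto simp: A_def)
    have AV: "A \<subseteq> V" by (auto simp: A_def)
    have split: "e' \<subseteq> A \<or> e' \<subseteq> V - A" if e': "e' \<in> E - {e}" for e'
    proof -
      obtain x y where xy: "e' = {x, y}" "x \<in> V" "y \<in> V"
        using drawn_edgeE[OF d] e' by (metis Diff_iff)
      have "(x, y) \<in> edge_rel (E - {e})" "(y, x) \<in> edge_rel (E - {e})"
        using xy e' by (auto simp: edge_rel_def insert_commute)
      then have "x \<in> A \<longleftrightarrow> y \<in> A" unfolding A_def using xy(2,3)
        by (auto intro: rtrancl.rtrancl_into_rtrancl)
      then show ?thesis using xy by auto
    qed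
    have X12: "?X' = X1 \<union> X2"
      using split AV unfolding X1_def X2_def picture_def by blast
    have d1: "drawn A {e'\<in>E - {e}. e' \<subseteq> A} p D"
      by (rule drawn_mono[OF d AV]) auto
    have d2: "drawn (V - A) {e'\<in>E - {e}. e' \<subseteq> V - A} p D"
      by (rule drawn_mono[OF d]) auto
    have inj: "inj_on p V" by (rule drawn_inj[OF d])
    have X12i: "X1 \<inter> X2 = {}"
    proof -
      have 1: "p ` A \<inter> p ` (V - A) = {}"
        using inj AV by (auto simp: inj_on_def)
      have 2: "p ` V \<inter> D e' \<subseteq> p ` e'" if "e' \<in> E" for e' using drawn_inter(1)[OF d that] by blast
      have 21: "p ` A \<inter> D e' = {}" if "e' \<in> E" "e' \<subseteq> V - A" for e'
        using 2[OF that(1)] that(2) inj AV 1 by blast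
      have 22: "p ` (V - A) \<inter> D e' = {}" if "e' \<in> E" "e' \<subseteq> A" for e'
        using 2[OF that(1)] that(2) inj AV 1 by blast
      have 3: "D e' \<inter> D e'' = {}" if "e' \<in> E" "e' \<subseteq> A" "e'' \<in> E" "e'' \<subseteq> V - A" for e' e''
      proof -
        have "e' \<noteq> {}" using drawn_edge_facts(6)[OF d that(1)] by auto
        then have "e' \<noteq> e''" using that(2,4) by blast
        then have "D e' \<inter> D e'' \<subseteq> p ` (e' \<inter> e'')" using drawn_inter(2)[OF d] that by blast
        then show ?thesis using that by blast
      qed
      have X1: "x \<in> p ` A \<or> (\<exists>e'. e' \<in> E \<and> e' \<subseteq> A \<and> x \<in> D e')" if "x \<in> X1" for x
        using that unfolding X1_def picture_def by blast
      have X2: "x \<in> p ` (V - A) \<or> (\<exists>e'. e' \<in> E \<and> e' \<subseteq> V - A \<and> x \<in> D e')" if "x \<in> X2" for x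
        using that unfolding X2_def picture_def by blast
      have "x \<notin> X2" if "x \<in> X1" for x
        using X1[OF that] X2[of x] 1 21 22 3 by (metis disjoint_iff)
      then show ?thesis by blast
    qed
    have puX: "p u \<in> X1" "p v \<in> X2" using uA uv unfolding X1_def X2_def picture_def by auto
    have cX12: "compact X1" "compact X2"
      using picture_compact[OF d1] picture_compact[OF d2] by (simp_all add: X1_def X2_def)
    have i1: "D e \<inter> X1 = {p u}" and i2: "(D e \<union> X1) \<inter> X2 = {p v}"
      using De X12 X12i puX uv by auto
    have eq: "f = f'" if f: "f \<in> ?T" "f' \<in> ?T" for f f'
    proof -
      obtain a b where ab: "a \<in> f" "b \<in> f'" using sub(3) f by blast
      have cc: "connected_component (- ?X') a b" using conn f ab by blast
      have cc1: "connected_component (- X1) a b" "connected_component (- X2) a b"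
        using cc X12 connected_component_of_subset[of "- ?X'"] by auto
      have ccD: "connected_component (- D e) a b"
        using drawn_edge_facts(2)[OF d e] ab sub(1)[OF f(1)] sub(1)[OF f(2)] X
        unfolding connected_component_def by blast
      \<comment> \<open>Janiszewski's theorem is used twice: the arc alone does not separate the
        plane, and \<open>X1\<close> and then \<open>X2\<close> meet what is already there in a
        single point.\<close>
      have "connected_component (- (D e \<union> X1)) a b"
        by (rule Janiszewski) (use i1 ccD cc1 drawn_edge_facts(1)[OF d e] cX12 compact_imp_closed in simp_all)
      then have "connected_component (- ((D e \<union> X1) \<union> X2)) a b"
        by (intro Janiszewski[of "D e \<union> X1"])
          (use i2 cc1 drawn_edge_facts(1)[OF d e] cX12 compact_imp_closed compact_Un in simp_all)
      moreover have "(D e \<union> X1) \<union> X2 = ?X" using X X12 by auto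
      ultimately have "connected_component (- ?X) a b" by simp
      then show ?thesis using components_eqI[of f "- ?X" f' a b] ab f by blast
    qed
    have "\<exists>x. ?T \<subseteq> {x}" by (rule ex_subset_singleton) (rule eq)
    then obtain x where Tx: "?T \<subseteq> {x}" ..
    then have "finite ?T" "card ?T \<le> card {x}" by (simp_all add: finite_subset card_mono del: card.insert)
    then show ?thesis by simp
  qed
qed

section \<open>Edges on the frontier of a face\<close>

lemma connected_Compl_insert:
  fixes K :: "complex set"
  assumes "compact K" "connected (- K)"
  shows "connected (- insert x K)"
proof -
  have "connected (- ({x} \<union> K))"
    by (rule Janiszewski_connected)
      (use assms compact_imp_closed connected_punctured_universe[of x] in \<open>auto simp: Int_insert_left\<close>)
  then show ?thesis by simp
qed

lemma connected_Compl_Un_finite: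
  fixes K :: "complex set"
  assumes "finite F" "compact K" "connected (- K)"
  shows "connected (- (F \<union> K))"
  using assms(1)
proof induction
  case (insert x F)
  then show ?case
    using connected_Compl_insert[of "F \<union> K" x] assms(2) by (simp add: compact_Un finite_imp_compact)
qed (use assms in simp)

text \<open>Two distinct edges share at most one endpoint, so their arcs meet in at most one point
  and by Janiszewski's theorem do not separate the plane; finitely many further points do not change
  this. Two is the limit, as three edges can form a triangle.\<close>

lemma connected_Compl_picture_le2:
  assumes d: "drawn V F p D" and "card F \<le> 2"
  shows "connected (- picture V F p D)"
proof -
  have fin: "finite V" "finite F" using drawn_finite[OF d] by auto
  have "compact (\<Union> (D ` F)) \<and> connected (- \<Union> (D ` F))"
  proof -
    consider "card F = 0" | "card F = 1" | "card F = 2" using assms(2) by linarith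
    then show ?thesis
    proof cases
      case 1 then show ?thesis using fin by (simp add: connected_UNIV)
    next
      case 2
      then obtain e where "F = {e}" by (auto simp: card_1_singleton_iff)
      then show ?thesis using drawn_edge_facts(1,2)[OF d] by auto
    next
      case 3
      then obtain e e' where ee: "F = {e, e'}" "e \<noteq> e'" by (auto simp: card_2_iff)
      then have c2: "card e = 2" "card e' = 2" using drawn_edge_facts(6)[OF d] by auto
      have s: "D e \<inter> D e' \<subseteq> p ` (e \<inter> e')" using drawn_inter(2)[OF d, of e e'] ee by blast
      have fe: "finite e" "finite e'" using c2 by (metis card.infinite zero_neq_numeral)+
      have "card (e \<inter> e') < 2"
        using c2 ee(2) fe by (metis card_mono card_subset_eq inf_le1 inf_le2 nless_le)
      then have "card (p ` (e \<inter> e')) \<le> 1"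
        using card_image_le[of "e \<inter> e'" p] fe by auto
      then have "card (D e \<inter> D e') \<le> 1"
        using s fe by (meson card_mono finite_Int finite_imageI le_trans)
      moreover have "finite (D e \<inter> D e')" using s fe by (meson finite_Int finite_imageI finite_subset)
      ultimately have "connected (D e \<inter> D e')"
        by (metis One_nat_def card_0_eq card_1_singletonE connected_empty connected_sing le_Suc_eq le_zero_eq)
      then have "connected (- (D e \<union> D e'))"
        using drawn_edge_facts(1,2)[OF d] ee compact_imp_closed by (intro Janiszewski_connected) auto
      then show ?thesis using drawn_edge_facts(1)[OF d] ee by (auto simp: compact_Un)
    qed
  qed
  then show ?thesis unfolding picture_def
    using connected_Compl_Un_finite[OF finite_imageI[OF fin(1)]] by blast
qed

text \<open>If \<open>f\<close> touched at most two edges, its frontier would lie in the picture of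
  these, which does not separate the plane. The face would then fill the whole complement of that
  picture and leave no room for a third edge.\<close>

lemma card_touched_edges:
  assumes d: "drawn V E p D" and "card E \<ge> 3" and f: "f \<in> components (- picture V E p D)"
  shows "card {e \<in> E. touches p D f e} \<ge> 3"
proof (rule ccontr)
  let ?X = "picture V E p D"
  define F where "F = {e \<in> E. touches p D f e}"
  assume "\<not> ?thesis"
  then have F: "card F \<le> 2" by (simp add: F_def)
  have fE: "finite E" using drawn_finite[OF d] by simp
  have FE: "F \<subseteq> E" by (auto simp: F_def)
  \<comment> \<open>All of \<open>V\<close> is kept, since the frontier may contain endpoints of
    edges that \<open>f\<close> does not touch.\<close>
  have dF: "drawn V F p D"
    using drawn_edge_facts(7)[OF d] FE by (intro drawn_mono[OF d]) auto
  let ?Y = "picture V F p D"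
  have clX: "closed ?X" using picture_compact[OF d] compact_imp_closed by blast
  have "frontier f \<subseteq> ?X" using frontier_of_components_closed_complement[OF clX f] .
  then have frY: "frontier f \<subseteq> ?Y"
  proof -
    have "x \<in> p ` V \<or> (\<exists>e\<in>F. x \<in> D e)" if x: "x \<in> frontier f" "e \<in> E" "x \<in> D e" for x e
    proof (cases "x \<in> p ` e")
      case True then show ?thesis using drawn_edge_facts(7)[OF d x(2)] by blast
    next
      case False then show ?thesis using x unfolding F_def touches_def by blast
    qed
    moreover have "x \<in> p ` V \<or> (\<exists>e\<in>E. x \<in> D e)" if "x \<in> frontier f" for x
      using subsetD[OF \<open>frontier f \<subseteq> ?X\<close> that] by (simp add: picture_def)
    ultimately have "x \<in> p ` V \<or> (\<exists>e\<in>F. x \<in> D e)" if "x \<in> frontier f" for x using that by metis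
    then show ?thesis by (auto simp: picture_def)
  qed
  have YX: "?Y \<subseteq> ?X" unfolding picture_def F_def by auto
  have fX: "f \<subseteq> - ?X" "f \<noteq> {}" using f in_components_subset in_components_nonempty by blast+
  have "open f" using f clX open_components[of "- ?X" f] by (simp add: open_Compl)
  have "- ?Y \<subseteq> f"
  proof (rule ccontr)
    assume n: "\<not> - ?Y \<subseteq> f"
    have "- ?Y \<inter> frontier f \<noteq> {}"
      using n fX YX connected_Compl_picture_le2[OF dF F] connected_Int_frontier[of "- ?Y" f] by blast
    then show False using frY by blast
  qed
  then have "?X \<subseteq> ?Y" using fX by blast
  moreover obtain e where e: "e \<in> E" "e \<notin> F"
    using assms(2) F FE card_mono[of F E] by (metis fE finite_subset not_less_eq_eq numeral_2_eq_2 numeral_3_eq_3 order_trans subsetI)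
  ultimately have "D e \<subseteq> ?Y" unfolding picture_def by blast
  then show False using edge_inter_picture[OF d e(1) FE e(2)] drawn_edge_facts(4)[OF d e(1)] by auto
qed

section \<open>Counting edges and faces\<close>

lemma three_faces_le_two_edges:
  assumes d: "drawn V E p D" and E3: "card E \<ge> 3"
  shows "finite (components (- picture V E p D)) \<and> 3 * card (components (- picture V E p D)) \<le> 2 * card E"
proof
  let ?Q = "components (- picture V E p D)"
  have fE: "finite E" using drawn_finite[OF d] by simp
  have T: "finite {f \<in> ?Q. touches p D f e}" "card {f \<in> ?Q. touches p D f e} \<le> 2" if "e \<in> E" for e
    using card_touching_faces[OF d that] by auto
  have c: "card {e \<in> E. touches p D f e} \<ge> 3" if "f \<in> ?Q" for f using card_touched_edges[OF d E3 that] .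
  \<comment> \<open>Finiteness of the set of faces comes out of the count as well: every face
    touches some edge, and an edge touches only finitely many faces.\<close>
  have "?Q \<subseteq> (\<Union>e\<in>E. {f \<in> ?Q. touches p D f e})"
  proof
    fix f assume "f \<in> ?Q"
    then have "{e \<in> E. touches p D f e} \<noteq> {}" using c[of f] by (metis card.empty not_numeral_le_zero)
    then show "f \<in> (\<Union>e\<in>E. {f \<in> ?Q. touches p D f e})" using \<open>f \<in> ?Q\<close> by blast
  qed
  then show fQ: "finite ?Q" using T fE by (meson finite_UN_I finite_subset)
  have "3 * card ?Q = (\<Sum>f\<in>?Q. 3)" by simp
  also have "\<dots> \<le> (\<Sum>f\<in>?Q. card {e \<in> E. touches p D f e})" by (intro sum_mono c)
  also have "\<dots> = (\<Sum>e\<in>E. card {f \<in> ?Q. touches p D f e})"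
    using sum_multicount_gen[OF fQ fE, of "\<lambda>f e. touches p D f e" "\<lambda>e. card {f \<in> ?Q. touches p D f e}"] by auto
  also have "\<dots> \<le> (\<Sum>e\<in>E. 2)" by (intro sum_mono T)
  finally show "3 * card ?Q \<le> 2 * card E" by simp
qed

text \<open>Sending a face to the face of the smaller picture that contains it is surjective but not
  injective: close to an inner point of the edge there are points inside and outside a Jordan curve,
  which lie in different faces as long as the edge is present.\<close>

lemma card_faces_remove_cycle_edge:
  assumes d: "drawn V E p D" and e: "{u, v} \<in> E" "u \<noteq> v"
    and r: "(u, v) \<in> (edge_rel (E - {{u, v}}))\<^sup>*"
    and fin: "finite (components (- picture V E p D))"
  shows "finite (components (- picture V (E - {{u, v}}) p D)) \<and>
         card (components (- picture V (E - {{u, v}}) p D)) < card (components (- picture V E p D))"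
proof -
  let ?X = "picture V E p D" and ?X' = "picture V (E - {{u, v}}) p D"
  let ?Q = "components (- ?X)" and ?Q' = "components (- ?X')"
  \<comment> \<open>The chosen point does not matter, because a face of \<open>?X\<close> lies
    within one face of \<open>?X'\<close>; this is \<open>ph\<close>.\<close>
  define \<phi> where "\<phi> f = connected_component_set (- ?X') (SOME a. a \<in> f)" for f
  have d': "drawn V (E - {{u, v}}) p D"
    using d drawn_edge_facts(7)[OF d] by (auto intro: drawn_mono)
  have op: "open (- ?X')" using compact_imp_closed[OF picture_compact[OF d']] by (simp add: open_Compl)
  have X: "?X = ?X' \<union> D {u, v}" by (rule picture_insert_edge[OF e(1)])
  have De: "D {u, v} \<inter> ?X' = p ` {u, v}" by (rule edge_inter_picture[OF d e(1)]) auto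
  obtain c where c: "simple_path c" "pathfinish c = pathstart c"
    "D {u, v} \<subseteq> path_image c" "path_image c \<subseteq> ?X" "connected (path_image c \<inter> ?X')"
    using Jordan_curve_through_edge[OF d e r] by blast
  note J = Jordan_inside_outside[OF c(1,2)]
  have JU: "inside (path_image c) \<union> outside (path_image c) = - path_image c" using J by (elim conjE)
  have JF: "frontier (inside (path_image c)) = path_image c" "frontier (outside (path_image c)) = path_image c"
    and JI: "inside (path_image c) \<inter> outside (path_image c) = {}" using J by simp_all
  have ph: "\<phi> (connected_component_set (- ?X) a) = connected_component_set (- ?X') a" if "a \<in> - ?X" for a
  proof -
    have "a \<in> connected_component_set (- ?X) a" using that by (simp add: connected_component_refl)
    then have "(SOME b. b \<in> connected_component_set (- ?X) a) \<in> connected_component_set (- ?X) a"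
      by (rule someI)
    then have "connected_component (- ?X') a (SOME b. b \<in> connected_component_set (- ?X) a)"
      using X connected_component_of_subset[of "- ?X" a _ "- ?X'"] by auto
    then show ?thesis unfolding \<phi>_def by (metis connected_component_eq mem_Collect_eq)
  qed
  \<comment> \<open>The curve is the frontier of each of its two sides, so a neighbourhood of a
    point of the edge contains points of both.\<close>
  have near: "\<exists>a. a \<in> g \<and> a \<in> S \<and> a \<notin> ?X"
    if g: "open g" "g \<subseteq> - ?X'" "z \<in> g" "z \<in> D {u, v}"
      and S: "frontier S = path_image c" "S \<inter> path_image c = {}" for g z S
  proof -
    have "z \<in> frontier S" using g(4) S(1) c(3) by blast
    then have "g \<inter> S \<noteq> {}"
      using g(1,3) open_Int_closure_eq_empty[OF g(1), of S] by (auto simp: frontier_def)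
    then obtain a where a: "a \<in> g" "a \<in> S" by blast
    have "a \<notin> D {u, v}" using a(2) S(2) c(3) by blast
    then show ?thesis using a g(2) X by blast
  qed
  have surj: "\<phi> ` ?Q = ?Q'"
  proof
    show "\<phi> ` ?Q \<subseteq> ?Q'" using ph X by (auto simp: components_def)
    show "?Q' \<subseteq> \<phi> ` ?Q"
    proof
      fix g assume g: "g \<in> ?Q'"
      then obtain z where z: "z \<in> g" using in_components_nonempty by blast
      have og: "open g" "g \<subseteq> - ?X'" using g open_components[OF op] in_components_subset by blast+
      have "\<exists>a. a \<in> g \<and> a \<notin> ?X"
      proof (cases "z \<in> D {u, v}")
        case True
        show ?thesis using near[OF og z True, of "inside (path_image c)"] JF JU by blast
      next
        case False then show ?thesis using z og X by blast
      qed
      then obtain a where a: "a \<in> g" "a \<in> - ?X" by blast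
      have "g = connected_component_set (- ?X') a"
        using g a(1) connected_component_eq by (auto simp: components_def)
      then show "g \<in> \<phi> ` ?Q" using ph[OF a(2)] a(2) by (auto simp: components_def)
    qed
  qed
  have "\<not> inj_on \<phi> ?Q"
  proof
    assume inj: "inj_on \<phi> ?Q"
    obtain z where z: "z \<in> D {u, v}" "z \<notin> p ` {u, v}" using drawn_edge_facts(4)[OF d e(1)] by blast
    define g where "g = connected_component_set (- ?X') z"
    have zg: "z \<in> g" "open g" "g \<subseteq> - ?X'"
      unfolding g_def using z De open_connected_component[OF op]
      by (auto simp: connected_component_refl dest: connected_component_in)
    obtain a where a: "a \<in> g" "a \<in> inside (path_image c)" "a \<notin> ?X"
      using near[OF zg(2,3,1) z(1), of "inside (path_image c)"] JF JU by blast
    obtain b where b: "b \<in> g" "b \<in> outside (path_image c)" "b \<notin> ?X"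
      using near[OF zg(2,3,1) z(1), of "outside (path_image c)"] JF JU by blast
    have "connected_component_set (- ?X') a = connected_component_set (- ?X') b"
      using a(1) b(1) unfolding g_def by (metis connected_component_eq)
    moreover have "connected_component_set (- ?X) a \<in> ?Q" "connected_component_set (- ?X) b \<in> ?Q"
      using a(3) b(3) by (simp_all add: componentsI)
    ultimately have "connected_component_set (- ?X) a = connected_component_set (- ?X) b"
      using inj_onD[OF inj] ph[of a] ph[of b] a(3) b(3) by simp
    then have "connected_component (- ?X) a b"
      using b(3) by (metis Compl_iff connected_component_refl mem_Collect_eq)
    then obtain T where T: "connected T" "T \<subseteq> - ?X" "a \<in> T" "b \<in> T" unfolding connected_component_def by blast
    have "T \<inter> inside (path_image c) \<noteq> {}" "T - inside (path_image c) \<noteq> {}" using T(3,4) a(2) b(2) JI by blast+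
    then have "T \<inter> path_image c \<noteq> {}" using connected_Int_frontier[OF T(1)] JF(1) by metis
    then show False using T c(4) by blast
  qed
  then have "card (\<phi> ` ?Q) < card ?Q"
    using fin by (metis card_image_le eq_card_imp_inj_on nless_le)
  then show ?thesis using surj finite_imageI[OF fin, of \<phi>] by simp
qed

text \<open>The last hypothesis makes every edge a bridge. Deleting one splits the vertices into two
  nonempty sets that no edge joins, and the spare 1 in one of the two bounds from the induction pays
  for the deleted edge.\<close>

lemma card_edges_acyclic:
  assumes "finite V" "V \<noteq> {}" "\<And>e. e \<in> E \<Longrightarrow> e \<subseteq> V \<and> card e = 2"
    and "\<And>u v. {u, v} \<in> E \<Longrightarrow> u \<noteq> v \<Longrightarrow> (u, v) \<notin> (edge_rel (E - {{u, v}}))\<^sup>*"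
  shows "card E + 1 \<le> card V"
  using assms
proof (induction "card V" arbitrary: V E rule: less_induct)
  case less
  have fE: "finite E" using less.prems(1,3) by (metis Pow_iff finite_Pow_iff finite_subset subsetI)
  show ?case
  proof (cases "E = {}")
    case True
    then show ?thesis using less.prems(1,2) by (simp add: Suc_leI card_gt_0_iff)
  next
    case False
    then obtain e where e: "e \<in> E" by blast
    then obtain u v where uv: "e = {u, v}" "u \<noteq> v" using less.prems(3) by (metis card_2_iff)
    define A where "A = (edge_rel (E - {e}))\<^sup>* `` {u} \<inter> V"
    define E1 where "E1 = {e' \<in> E - {e}. e' \<subseteq> A}"
    define E2 where "E2 = {e' \<in> E - {e}. e' \<subseteq> V - A}"
    have uvV: "u \<in> V" "v \<in> V" using less.prems(3)[OF e] uv by auto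
    have uA: "u \<in> A" "v \<in> V - A" using less.prems(4)[of u v] e uv uvV by (auto simp: A_def)
    have AV: "A \<subset> V" "V - A \<subset> V" using uA by (auto simp: A_def)
    have split: "e' \<subseteq> A \<or> e' \<subseteq> V - A" if e': "e' \<in> E - {e}" for e'
    proof -
      obtain x y where xy: "e' = {x, y}" "x \<in> V" "y \<in> V"
        using less.prems(3) e' by (metis DiffD1 card_2_iff insert_subset)
      have "(x, y) \<in> edge_rel (E - {e})" "(y, x) \<in> edge_rel (E - {e})"
        using xy e' by (auto simp: edge_rel_def insert_commute)
      then have "x \<in> A \<longleftrightarrow> y \<in> A" unfolding A_def using xy(2,3)
        by (auto intro: rtrancl.rtrancl_into_rtrancl)
      then show ?thesis using xy by auto
    qed
    have acyc: "(x, y) \<notin> (edge_rel (F - {{x, y}}))\<^sup>*" if "{x, y} \<in> F" "x \<noteq> y" "F \<subseteq> E" for x y F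
    proof -
      have "edge_rel (F - {{x, y}}) \<subseteq> edge_rel (E - {{x, y}})" using that by (auto simp: edge_rel_def)
      then show ?thesis using less.prems(4)[of x y] that rtrancl_mono by blast
    qed
    have "card E1 + 1 \<le> card A"
      using AV uA less.prems(1,3) acyc
      by (intro less.hyps psubset_card_mono) (auto simp: E1_def finite_subset)
    moreover have "card E2 + 1 \<le> card (V - A)"
      using AV uA less.prems(1,3) acyc
      by (intro less.hyps psubset_card_mono) (auto simp: E2_def finite_subset)
    moreover have "card E \<le> card E1 + card E2 + 1"
    proof -
      have "E = insert e (E1 \<union> E2)" using split e by (auto simp: E1_def E2_def)
      then have "card E \<le> Suc (card (E1 \<union> E2))" by (metis card_insert_le_m1 card_insert_if fE finite_insert le_SucI order_refl)
      then show ?thesis using card_Un_le[of E1 E2] by linarith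
    qed
    moreover have "card A + card (V - A) = card V"
      using AV less.prems(1) by (metis card_Diff_subset card_mono finite_subset le_add_diff_inverse psubset_imp_subset)
    ultimately show ?thesis by linarith
  qed
qed

text \<open>One half of Euler's formula, valid for disconnected graphs too: deleting an edge of a
  cycle loses at least one face, and a graph without cycles has fewer edges than vertices.\<close>

lemma euler_lower_bound:
  assumes "drawn V E p D" "V \<noteq> {}" "finite (components (- picture V E p D))"
  shows "card E + 1 \<le> card V + card (components (- picture V E p D))"
  using assms
proof (induction "card E" arbitrary: E rule: less_induct)
  case less
  let ?Q = "components (- picture V E p D)"
  note d = less.prems(1)
  have fin: "finite V" "finite E" using drawn_finite[OF d] by auto
  show ?case
  proof (cases "\<exists>u v. {u, v} \<in> E \<and> u \<noteq> v \<and> (u, v) \<in> (edge_rel (E - {{u, v}}))\<^sup>*")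
    case True
    then obtain u v where uv: "{u, v} \<in> E" "u \<noteq> v" "(u, v) \<in> (edge_rel (E - {{u, v}}))\<^sup>*" by blast
    have lt: "card (E - {{u, v}}) < card E" using uv(1) fin by (meson card_Diff1_less)
    have "drawn V (E - {{u, v}}) p D"
      using d drawn_edge_facts(7)[OF d] by (auto intro: drawn_mono)
    then have "card (E - {{u, v}}) + 1 \<le> card V + card (components (- picture V (E - {{u, v}}) p D))"
      using card_faces_remove_cycle_edge[OF d uv less.prems(3)] less.prems(2) lt by (intro less.hyps) auto
    then show ?thesis
      using card_faces_remove_cycle_edge[OF d uv less.prems(3)] lt uv(1) fin by (simp add: card_Diff_singleton)
  next
    case False
    then have "card E + 1 \<le> card V"
      using drawn_edge_facts(6,7)[OF d] fin less.prems(2) by (intro card_edges_acyclic) auto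
    then show ?thesis by simp
  qed
qed

text \<open>Three times Euler's inequality, with the faces replaced by two thirds of the edges. The
  constant is 3 instead of the familiar 6, so that the bound also holds for a single vertex; later
  only its strictness matters.\<close>

lemma drawn_edge_bound:
  assumes d: "drawn V E p D" and "V \<noteq> {}"
  shows "card E + 3 \<le> 3 * card V"
proof (cases "card E \<ge> 3")
  case True
  then show ?thesis
    using three_faces_le_two_edges[OF d True] euler_lower_bound[OF d assms(2)] by linarith
next
  case False
  have fin: "finite V" using drawn_finite[OF d] by auto
  show ?thesis
  proof (cases "E = {}")
    case True
    then show ?thesis using assms(2) fin by (simp add: Suc_leI card_gt_0_iff)
  next
    case False
    then obtain e where "e \<in> E" by blast
    then have "2 \<le> card V" using drawn_edge_facts(6,7)[OF d] fin card_mono by metis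
    then show ?thesis using \<open>\<not> 3 \<le> card E\<close> by linarith
  qed
qed

subsection \<open>Independent transversals\<close>

definition indep_transversal :: "('i \<Rightarrow> 'v set) \<Rightarrow> ('v \<Rightarrow> 'v \<Rightarrow> bool) \<Rightarrow> 'i set \<Rightarrow> ('i \<Rightarrow> 'v) \<Rightarrow> bool" where
  "indep_transversal P H I t \<longleftrightarrow>
     (\<forall>i\<in>I. t i \<in> P i) \<and> (\<forall>i\<in>I. \<forall>j\<in>I. i \<noteq> j \<longrightarrow> \<not> H (t i) (t j))"

text \<open>The induction step picks \<open>v\<close> in the part \<open>r\<close> and a transversal \<open>t\<close> of the other parts with as
  few neighbours of \<open>v\<close> as possible, and merges the parts of these neighbours into \<open>r\<close>.\<close>

lemma dominated_parts_rooted: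
  fixes P :: "'i \<Rightarrow> 'v set"
  assumes "finite I" "r \<in> I" "symp H"
    and "\<nexists>t. indep_transversal P H I t" "\<exists>t. indep_transversal P H (I - {r}) t"
  shows "\<exists>S Z. r \<in> S \<and> S \<subseteq> I \<and> finite Z \<and> Z \<subseteq> \<Union> (P ` I) \<and> card Z + 2 \<le> 2 * card S \<and>
           (\<forall>u\<in>\<Union> (P ` S). \<exists>z\<in>Z. H z u)"
  using assms
proof (induction "card I" arbitrary: I P rule: less_induct)
  case less
  have sym: "H a b \<Longrightarrow> H b a" for a b using less.prems(3) by (auto dest: sympD)
  show ?case
  proof (cases "P r = {}")
    case True
    then show ?thesis using less.prems(2) by (intro exI[of _ "{r}"] exI[of _ "{}"]) auto
  next
    case False
    then obtain v where v: "v \<in> P r" by blast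
    define N where "N t = {i \<in> I - {r}. H v (t i)}" for t
    obtain t where t: "indep_transversal P H (I - {r}) t"
      and tmin: "\<And>t'. indep_transversal P H (I - {r}) t' \<Longrightarrow> card (N t) \<le> card (N t')"
      using ex_has_least_nat[of "indep_transversal P H (I - {r})" _ "\<lambda>t. card (N t)"] less.prems(5) by blast
    define J where "J = N t"
    have J: "J \<subseteq> I - {r}" "finite J" using less.prems(1) by (auto simp: J_def N_def)
    have tP: "t i \<in> P i" if "i \<in> I" "i \<noteq> r" for i using t that by (auto simp: indep_transversal_def)
    have tI: "\<not> H (t i) (t j)" if "i \<in> I" "i \<noteq> r" "j \<in> I" "j \<noteq> r" "i \<noteq> j" for i j
      using t that by (auto simp: indep_transversal_def)
    have "J \<noteq> {}"
    proof
      assume "J = {}"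
      then have "\<not> H v (t i)" "\<not> H (t i) v" if "i \<in> I" "i \<noteq> r" for i
        using that sym[of "t i" v] by (auto simp: J_def N_def)
      then have "indep_transversal P H I (t(r := v))"
        using tP tI v by (auto simp: indep_transversal_def)
      then show False using less.prems(4) by blast
    qed
    \<comment> \<open>\<open>B\<close> is what \<open>v\<close> and the chosen vertices of the parts
      in \<open>J\<close> dominate. Outside \<open>J\<close>, the vertices of \<open>t\<close>
      survive its deletion, and whatever else survives is compatible with \<open>t\<close> on
      \<open>J\<close>.\<close>
    define B where "B = {u. H v u \<or> (\<exists>j\<in>J. H (t j) u)}"
    define P' where "P' i = (if i = r then (P r \<union> \<Union> (P ` J)) - B else P i - B)" for i
    have lt: "card (I - J) < card I"
      using less.prems(1) J \<open>J \<noteq> {}\<close> by (intro psubset_card_mono) auto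
    have rI: "r \<in> I - J" using less.prems(2) J by blast
    have "indep_transversal P' H (I - J - {r}) t"
      using tP tI J by (auto simp: indep_transversal_def P'_def B_def J_def N_def)
    then have yes: "\<exists>t. indep_transversal P' H (I - J - {r}) t" by blast
    have no: "\<nexists>t. indep_transversal P' H (I - J) t"
    proof
      assume "\<exists>t'. indep_transversal P' H (I - J) t'"
      then obtain t' where t': "indep_transversal P' H (I - J) t'" by blast
      have t'P: "t' i \<in> P' i" if "i \<in> I" "i \<notin> J" for i using t' that by (auto simp: indep_transversal_def)
      have t'I: "\<not> H (t' i) (t' j)" if "i \<in> I" "i \<notin> J" "j \<in> I" "j \<notin> J" "i \<noteq> j" for i j
        using t' that by (auto simp: indep_transversal_def)
      have t'B: "t' i \<notin> B" if "i \<in> I" "i \<notin> J" for i using t'P[OF that] by (auto simp: P'_def split: if_splits)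
      have t'P2: "t' i \<in> P i" if "i \<in> I" "i \<notin> J" "i \<noteq> r" for i using t'P[OF that(1,2)] that(3) by (auto simp: P'_def)
      have tt': "\<not> H (t j) (t' i)" "\<not> H (t' i) (t j)" if "i \<in> I" "i \<notin> J" "j \<in> J" for i j
        using t'B[OF that(1,2)] that(3) sym by (auto simp: B_def)
      have "t' r \<in> P r \<or> (\<exists>j\<in>J. t' r \<in> P j)" using t'P[of r] rI by (auto simp: P'_def)
      then show False
      proof
        \<comment> \<open>\<open>t'\<close> avoids everything dominated by \<open>t\<close> on
          \<open>J\<close>, so the two combine to a transversal of all parts.\<close>
        assume r: "t' r \<in> P r"
        define s where "s i = (if i \<in> J then t i else t' i)" for i
        have "s a \<in> P a" if "a \<in> I" for a
          unfolding s_def using that r t'P2[of a] tP[of a] J by (cases "a = r") auto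
        moreover have "\<not> H (s a) (s b)" if "a \<in> I" "b \<in> I" "a \<noteq> b" for a b
          unfolding s_def using that t'I[of a b] tt'[of a b] tt'[of b a] tI[of a b] J by auto
        ultimately have "indep_transversal P H I s" by (auto simp: indep_transversal_def)
        then show False using less.prems(4) by blast
      next
        \<comment> \<open>Here \<open>t' r\<close> replaces \<open>t j\<close>. All values of
          \<open>t'\<close> lie outside \<open>B\<close>, so the new transversal of the parts other
          than \<open>r\<close> has fewer neighbours of \<open>v\<close> than \<open>t\<close>,
          against the choice of \<open>t\<close>.\<close>
        assume "\<exists>j\<in>J. t' r \<in> P j"
        then obtain j where j: "j \<in> J" "t' r \<in> P j" by blast
        define s where "s i = (if i = j then t' r else if i \<in> J then t i else t' i)" for i
        have "\<not> H (s a) (s b)" if "a \<in> I - {r}" "b \<in> I - {r}" "a \<noteq> b" for a b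
          using that t'I[of a b] t'I[of r b] t'I[of a r] tt'[of a b] tt'[of b a] tt'[of r b] tt'[of r a] tI[of a b] J rI j
          unfolding s_def by auto
        moreover have "s a \<in> P a" if "a \<in> I - {r}" for a
          using that t'P2[of a] tP[of a] J j unfolding s_def by auto
        ultimately have "indep_transversal P H (I - {r}) s" by (auto simp: indep_transversal_def)
        then have "card J \<le> card (N s)" using tmin by (simp add: J_def)
        moreover have "N s \<subseteq> J - {j}"
          using t'B rI by (auto simp: N_def s_def B_def J_def split: if_splits)
        then have "card (N s) < card J" using J(2) j(1) by (meson card_mono card_Diff1_less finite_Diff le_less_trans)
        ultimately show False by simp
      qed
    qed
    obtain S Z where SZ: "r \<in> S" "S \<subseteq> I - J" "finite Z" "Z \<subseteq> \<Union> (P' ` (I - J))" "card Z + 2 \<le> 2 * card S"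
      "\<forall>u\<in>\<Union> (P' ` S). \<exists>z\<in>Z. H z u"
      using less.hyps[OF lt _ rI less.prems(3) no yes] less.prems(1) by auto
    have "finite S" using SZ(2) less.prems(1) by (meson finite_Diff finite_subset)
    then have cS: "card (S \<union> J) = card S + card J" using SZ(2) J by (intro card_Un_disjoint) auto
    have "card (Z \<union> insert v (t ` J)) \<le> card Z + (1 + card J)"
      using card_Un_le[of Z "insert v (t ` J)"] card_insert_le_m1 card_image_le[OF J(2), of t] J(2)
      by (simp add: card_insert_if split: if_splits)
    \<comment> \<open>The step gains \<open>card J\<close> parts for at most
      \<open>1 + card J\<close> dominating vertices, and \<open>J\<close> is nonempty.\<close>
    then have c: "card (Z \<union> insert v (t ` J)) + 2 \<le> 2 * card (S \<union> J)"
    proof -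
      have "1 \<le> card J" using \<open>J \<noteq> {}\<close> J(2) by (simp add: card_gt_0_iff Suc_leI)
      then show ?thesis
        using cS SZ(5) \<open>card (Z \<union> insert v (t ` J)) \<le> card Z + (1 + card J)\<close> by linarith
    qed
    have "P' i \<subseteq> \<Union> (P ` I)" if "i \<in> I" for i using that J by (auto simp: P'_def)
    then have "\<Union> (P' ` (I - J)) \<subseteq> \<Union> (P ` I)" by (intro UN_least) auto
    then have ZI: "Z \<subseteq> \<Union> (P ` I)" using SZ(4) by (rule order_trans[rotated])
    have dom: "\<exists>z\<in>Z \<union> insert v (t ` J). H z u" if "i \<in> S \<union> J" "u \<in> P i" for i u
    proof (cases "u \<in> B")
      case True then show ?thesis by (auto simp: B_def)
    next
      case False
      then have "u \<in> \<Union> (P' ` S)"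
        using that SZ(1) by (cases "i \<in> J") (auto simp: P'_def)
      then show ?thesis using SZ(6) by blast
    qed
    have "S \<union> J \<subseteq> I" "t ` J \<subseteq> \<Union> (P ` I)" "v \<in> \<Union> (P ` I)"
      using SZ(2) J v less.prems(2) tP by auto
    then have "Z \<union> insert v (t ` J) \<subseteq> \<Union> (P ` I)" using ZI by simp
    moreover have "\<forall>u\<in>\<Union> (P ` (S \<union> J)). \<exists>z\<in>Z \<union> insert v (t ` J). H z u"
      using dom by (metis UN_E)
    ultimately show ?thesis
      using c SZ(1,3) J(2) \<open>S \<union> J \<subseteq> I\<close>
      by (intro exI[of _ "S \<union> J"] exI[of _ "Z \<union> insert v (t ` J)"] conjI) simp_all
  qed
qed

text \<open>Haxell's theorem. In a minimal family of parts without a transversal, some subfamily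
  \<open>S\<close> is dominated by fewer than \<open>2 * card S\<close> vertices. These dominate
  fewer than \<open>2 * \<Delta> * card S\<close> vertices, but the parts of \<open>S\<close>
  contain at least that many.\<close>

lemma indep_transversal_exists:
  fixes P :: "'i \<Rightarrow> 'v set"
  assumes "finite I" "symp H" "\<Delta> > 0"
    and disj: "\<And>i j. i \<in> I \<Longrightarrow> j \<in> I \<Longrightarrow> i \<noteq> j \<Longrightarrow> P i \<inter> P j = {}"
    and big: "\<And>i. i \<in> I \<Longrightarrow> 2 * \<Delta> \<le> card (P i)"
    and deg: "\<And>z. z \<in> \<Union> (P ` I) \<Longrightarrow> card {u \<in> \<Union> (P ` I). H z u} \<le> \<Delta>"
  shows "\<exists>t. indep_transversal P H I t"
proof (rule ccontr)
  let ?bad = "\<lambda>I'. I' \<subseteq> I \<and> (\<nexists>t. indep_transversal P H I' t)"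
  assume "\<nexists>t. indep_transversal P H I t"
  then have "?bad I" by simp
  then obtain I0 where "?bad I0 \<and> (\<forall>I'. ?bad I' \<longrightarrow> card I0 \<le> card I')"
    using ex_has_least_nat[of ?bad I card] by auto
  then have I0: "I0 \<subseteq> I" "\<nexists>t. indep_transversal P H I0 t"
    and I0min: "\<And>I'. ?bad I' \<Longrightarrow> card I0 \<le> card I'" by simp_all
  have fI0: "finite I0" using I0(1) assms(1) finite_subset by blast
  have "I0 \<noteq> {}" using I0(2) by (auto simp: indep_transversal_def)
  then obtain r where r: "r \<in> I0" by blast
  have "card (I0 - {r}) < card I0" using r fI0 by (rule card_Diff1_less[rotated])
  then have "\<exists>t. indep_transversal P H (I0 - {r}) t" using I0min[of "I0 - {r}"] I0(1) by (auto simp: not_le[symmetric])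
  from dominated_parts_rooted[OF fI0 r assms(2) I0(2) this]
  obtain S Z where SZ: "r \<in> S" "S \<subseteq> I0" "finite Z" "Z \<subseteq> \<Union> (P ` I0)" "card Z + 2 \<le> 2 * card S"
      "\<forall>u\<in>\<Union> (P ` S). \<exists>z\<in>Z. H z u" by blast
  have SI: "S \<subseteq> I" "finite S" using SZ(2) I0(1) fI0 finite_subset by blast+
  have fin: "finite (P i)" if "i \<in> I" for i
    using big[OF that] assms(3) by (metis card.infinite le_zero_eq mult_is_0 not_gr_zero zero_neq_numeral)
  have fU: "finite (\<Union> (P ` I))" using fin assms(1) by blast
  have "2 * \<Delta> * card S = (\<Sum>i\<in>S. 2 * \<Delta>)" by simp
  also have "\<dots> \<le> (\<Sum>i\<in>S. card (P i))" using big SI by (intro sum_mono) auto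
  also have "\<dots> = card (\<Union> (P ` S))"
    using SI fin disj by (subst card_UN_disjoint) (auto simp: subset_iff)
  also have "\<dots> \<le> card (\<Union>z\<in>Z. {u \<in> \<Union> (P ` I). H z u})"
  proof (rule card_mono)
    show "finite (\<Union>z\<in>Z. {u \<in> \<Union> (P ` I). H z u})"
      by (rule finite_subset[OF _ fU]) blast
    show "\<Union> (P ` S) \<subseteq> (\<Union>z\<in>Z. {u \<in> \<Union> (P ` I). H z u})"
    proof
      fix u assume u: "u \<in> \<Union> (P ` S)"
      then obtain z where "z \<in> Z" "H z u" using SZ(6) by metis
      moreover have "u \<in> \<Union> (P ` I)" using u SI(1) by auto
      ultimately show "u \<in> (\<Union>z\<in>Z. {u \<in> \<Union> (P ` I). H z u})" by auto
    qed
  qed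
  also have "\<dots> \<le> (\<Sum>z\<in>Z. card {u \<in> \<Union> (P ` I). H z u})"
    using SZ(3) by (rule card_UN_le)
  also have "\<dots> \<le> (\<Sum>z\<in>Z. \<Delta>)"
  proof (intro sum_mono deg)
    show "z \<in> \<Union> (P ` I)" if "z \<in> Z" for z
      using subsetD[OF SZ(4) that] I0(1) by auto
  qed
  also have "\<dots> = \<Delta> * card Z" by simp
  also have "\<dots> < 2 * \<Delta> * card S"
  proof -
    have "card Z < 2 * card S" using SZ(5) by linarith
    then have "\<Delta> * card Z < \<Delta> * (2 * card S)" using assms(3) by simp
    then show ?thesis by (simp add: ac_simps)
  qed
  finally show False by simp
qed

subsection \<open>Reduction to large lists\<close>

definition mono_rel :: "('a \<times> 'a) set \<Rightarrow> 'a set \<Rightarrow> ('a \<Rightarrow> 'c) \<Rightarrow> ('a \<times> 'a) set" where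
  "mono_rel R S f = {(u, w) \<in> R. u \<in> S \<and> w \<in> S \<and> f u = f w}"

definition clustered :: "('a \<times> 'a) set \<Rightarrow> 'a set \<Rightarrow> ('a \<Rightarrow> 'c) \<Rightarrow> nat \<Rightarrow> bool" where
  "clustered R S f c \<longleftrightarrow> (\<forall>v\<in>S. card ((mono_rel R S f)\<^sup>* `` {v}) \<le> c)"

text \<open>The parameter \<open>a\<close> is \<open>4\<close> for monochromatic degree 1 and \<open>3\<close> for monochromatic degree 2.\<close>

definition slack :: "int \<Rightarrow> 'a set \<Rightarrow> ('a \<times> 'a) set \<Rightarrow> ('a \<Rightarrow> 'c set) \<Rightarrow> bool" where
  "slack a V R L \<longleftrightarrow> (\<forall>C \<subseteq> V. C \<noteq> {} \<longrightarrow>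
     (\<Sum>v\<in>C. int (card (R `` {v} \<inter> C))) <
     (\<Sum>v\<in>C. a * int (card (L v)) - (a - 2) * int (card (R `` {v}))))"

locale list_graph =
  fixes V :: "'a set" and R :: "('a \<times> 'a) set" and L :: "'a \<Rightarrow> 'c set"
  assumes finite_V: "finite V" and R_sub: "R \<subseteq> V \<times> V" and sym_R: "sym R" and irrefl_R: "irrefl R"
    and finite_L: "v \<in> V \<Longrightarrow> finite (L v)" and L_nonempty: "v \<in> V \<Longrightarrow> L v \<noteq> {}"

lemma sum_card_sym:
  assumes "finite X" "finite Y" "sym R"
  shows "(\<Sum>v\<in>X. card (R `` {v} \<inter> Y)) = (\<Sum>v\<in>Y. card (R `` {v} \<inter> X))"
proof -
  have "(\<Sum>v\<in>X. card {w \<in> Y. (v, w) \<in> R}) = (\<Sum>w\<in>Y. card {v \<in> X. (v, w) \<in> R})"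
    using assms(1,2) by (intro sum_multicount_gen) auto
  moreover have "{w \<in> Y. (v, w) \<in> R} = R `` {v} \<inter> Y" "{w \<in> X. (w, v) \<in> R} = R `` {v} \<inter> X" for v
    using assms(3) by (auto dest: symD)
  ultimately show ?thesis by simp
qed

lemma card_Image_split:
  assumes "finite A" "C \<subseteq> A"
  shows "card (R `` {v} \<inter> A) = card (R `` {v} \<inter> (A - C)) + card (R `` {v} \<inter> C)"
proof -
  have "R `` {v} \<inter> A = (R `` {v} \<inter> (A - C)) \<union> (R `` {v} \<inter> C)" using assms(2) by auto
  moreover have "card ((R `` {v} \<inter> (A - C)) \<union> (R `` {v} \<inter> C)) =
      card (R `` {v} \<inter> (A - C)) + card (R `` {v} \<inter> C)"
    using assms finite_subset[OF assms(2,1)] by (intro card_Un_disjoint) auto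
  ultimately show ?thesis by simp
qed

text \<open>Deleting \<open>C\<close> removes the edges of \<open>A\<close> that meet
  \<open>C\<close>. In the degree sum over \<open>C\<close> the edges inside \<open>C\<close> count
  twice, and the second summand on the left corrects this.\<close>

lemma sum_degrees_remove:
  assumes "finite A" "C \<subseteq> A" "sym R"
  shows "(\<Sum>v\<in>A. card (R `` {v} \<inter> A)) + (\<Sum>v\<in>C. card (R `` {v} \<inter> C)) =
         (\<Sum>v\<in>A - C. card (R `` {v} \<inter> (A - C))) + 2 * (\<Sum>v\<in>C. card (R `` {v} \<inter> A))"
proof -
  have fC: "finite C" using assms finite_subset by blast
  have 1: "(\<Sum>v\<in>X. card (R `` {v} \<inter> A)) = (\<Sum>v\<in>X. card (R `` {v} \<inter> (A - C))) + (\<Sum>v\<in>X. card (R `` {v} \<inter> C))" for X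
    unfolding sum.distrib[symmetric] by (intro sum.cong card_Image_split assms refl)
  have 2: "(\<Sum>v\<in>A. card (R `` {v} \<inter> A)) = (\<Sum>v\<in>A - C. card (R `` {v} \<inter> A)) + (\<Sum>v\<in>C. card (R `` {v} \<inter> A))"
    using assms(1,2) by (metis add.commute sum.subset_diff)
  have 3: "(\<Sum>v\<in>A - C. card (R `` {v} \<inter> C)) = (\<Sum>v\<in>C. card (R `` {v} \<inter> (A - C)))"
    by (rule sum_card_sym) (use assms fC in auto)
  show ?thesis using 1[of "A - C"] 1[of C] 2 3 by linarith
qed

lemma clustered_join:
  assumes "B \<inter> A = {}" "clustered R B g c" "clustered (R \<inter> A \<times> A) A h c" "sym R"
    and sep: "\<And>v u. v \<in> A \<Longrightarrow> u \<in> B \<Longrightarrow> (v, u) \<in> R \<Longrightarrow> h v \<noteq> g u"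
  shows "clustered R (B \<union> A) (\<lambda>v. if v \<in> B then g v else h v) c"
  unfolding clustered_def
proof
  let ?f = "\<lambda>v. if v \<in> B then g v else h v"
  have step: "(x, y) \<in> mono_rel R (B \<union> A) ?f \<Longrightarrow>
    (x \<in> B \<and> y \<in> B \<and> (x, y) \<in> mono_rel R B g) \<or> (x \<in> A \<and> y \<in> A \<and> (x, y) \<in> mono_rel (R \<inter> A \<times> A) A h)" for x y
    using sep[of x y] sep[of y x] symD[OF assms(4), of x y] assms(1)
    by (auto simp: mono_rel_def split: if_splits)
  fix v assume "v \<in> B \<union> A"
  then show "card ((mono_rel R (B \<union> A) ?f)\<^sup>* `` {v}) \<le> c"
  proof
    assume v: "v \<in> B"
    have "x \<in> B \<and> (v, x) \<in> (mono_rel R B g)\<^sup>*" if "(v, x) \<in> (mono_rel R (B \<union> A) ?f)\<^sup>*" for x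
      using that by (induction rule: rtrancl_induct) (use v assms(1) step in \<open>auto intro: rtrancl.rtrancl_into_rtrancl\<close>)
    moreover have "(v, x) \<in> (mono_rel R (B \<union> A) ?f)\<^sup>*" if "(v, x) \<in> (mono_rel R B g)\<^sup>*" for x
    proof -
      have "mono_rel R B g \<subseteq> mono_rel R (B \<union> A) ?f" by (auto simp: mono_rel_def)
      then show ?thesis using that rtrancl_mono by blast
    qed
    ultimately have "(mono_rel R (B \<union> A) ?f)\<^sup>* `` {v} = (mono_rel R B g)\<^sup>* `` {v}" by blast
    then show ?thesis using assms(2) v by (simp add: clustered_def)
  next
    assume v: "v \<in> A"
    have "x \<in> A \<and> (v, x) \<in> (mono_rel (R \<inter> A \<times> A) A h)\<^sup>*" if "(v, x) \<in> (mono_rel R (B \<union> A) ?f)\<^sup>*" for x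
      using that by (induction rule: rtrancl_induct) (use v assms(1) step in \<open>auto intro: rtrancl.rtrancl_into_rtrancl\<close>)
    moreover have "(v, x) \<in> (mono_rel R (B \<union> A) ?f)\<^sup>*" if "(v, x) \<in> (mono_rel (R \<inter> A \<times> A) A h)\<^sup>*" for x
    proof -
      have "mono_rel (R \<inter> A \<times> A) A h \<subseteq> mono_rel R (B \<union> A) ?f" using assms(1) by (auto simp: mono_rel_def)
      then show ?thesis using that rtrancl_mono by blast
    qed
    ultimately have "(mono_rel R (B \<union> A) ?f)\<^sup>* `` {v} = (mono_rel (R \<inter> A \<times> A) A h)\<^sup>* `` {v}" by blast
    then show ?thesis using assms(3) v by (simp add: clustered_def)
  qed
qed

text \<open>Both list sizes share this reduction; they differ in \<open>a\<close> and in
  \<open>ext\<close>, which colours the remaining set \<open>A\<close> from the lists left over by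
  \<open>B\<close>.\<close>

lemma choosable_if_sparse:
  fixes L :: "'a \<Rightarrow> 'c set" and a :: int
  assumes fV: "finite V" and symR: "sym R" and irR: "irrefl R" and a: "a \<ge> 2"
    and sparse: "\<And>S. S \<subseteq> V \<Longrightarrow> S \<noteq> {} \<Longrightarrow>
        (a - 1) * int (\<Sum>v\<in>S. card (R `` {v} \<inter> S)) < a * int k * int (card S)"
    and ext: "\<And>A (L' :: 'a \<Rightarrow> 'c set). list_graph A (R \<inter> A \<times> A) L' \<Longrightarrow> \<forall>v\<in>A. card (L' v) \<le> k \<Longrightarrow>
        slack a A (R \<inter> A \<times> A) L' \<Longrightarrow> \<exists>h. (\<forall>v\<in>A. h v \<in> L' v) \<and> clustered (R \<inter> A \<times> A) A h c"
    and lists: "\<forall>v\<in>V. infinite (L v) \<or> k \<le> card (L v)"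
  shows "\<exists>f. (\<forall>v\<in>V. f v \<in> L v) \<and> clustered R V f c"
proof -
  \<comment> \<open>Cutting the lists to exactly \<open>k\<close> colours makes them finite and
    yields the upper bound on the size of lists that \<open>ext\<close> may use.\<close>
  have "\<exists>X\<subseteq>L v. finite X \<and> card X = k" if "v \<in> V" for v
    using lists that by (metis infinite_arbitrarily_large obtain_subset_with_card_n)
  then obtain K where K: "\<And>v. v \<in> V \<Longrightarrow> K v \<subseteq> L v \<and> finite (K v) \<and> card (K v) = k" by metis
  define d where "d A v = int (card (R `` {v} \<inter> A))" for A v
  have "\<exists>f. (\<forall>v\<in>S. f v \<in> K v) \<and> clustered R S f c" if "S \<subseteq> V" for S
    using that
  proof (induction "card S" arbitrary: S rule: less_induct)
    case less
    have fS: "finite S" using less.prems fV finite_subset by blast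
    show ?case
    proof (cases "S = {}")
      case True then show ?thesis by (simp add: clustered_def)
    next
      case False
      \<comment> \<open>The bracket that is subtracted is twice the number of edges meeting
        \<open>B\<close>. Sparsity makes \<open>g S\<close> negative, so a maximal \<open>B\<close>
        is a proper subset, to which the induction hypothesis applies.\<close>
      define g where "g B = a * (\<Sum>v\<in>B. d S v - int k) - ((\<Sum>v\<in>S. d S v) - (\<Sum>v\<in>S - B. d (S - B) v))" for B
      let ?F = "{B. B \<subseteq> S \<and> g B \<ge> 0}"
      have "{} \<in> ?F" by (simp add: g_def)
      moreover have "finite ?F" using fS by simp
      ultimately obtain B where B: "B \<in> ?F" and Bmax: "\<And>X. X \<in> ?F \<Longrightarrow> B \<subseteq> X \<Longrightarrow> X = B"
        using finite_has_maximal[of ?F] by (metis (no_types, lifting) empty_iff)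
      define A where "A = S - B"
      have "g S < 0"
      proof -
        have "g S = (a - 1) * (\<Sum>v\<in>S. d S v) - a * int k * int (card S)"
          by (simp add: g_def sum_subtractf algebra_simps)
        then show ?thesis using sparse[OF less.prems False] by (simp add: d_def)
      qed
      then have "B \<subset> S" using B by auto
      then have "card B < card S" using fS by (rule psubset_card_mono[rotated])
      then obtain b where b: "\<forall>v\<in>B. b v \<in> K v" "clustered R B b c"
        using less.hyps[of B] B less.prems by auto
      define L' where "L' v = K v - b ` (R `` {v} \<inter> B)" for v
      have fA: "finite A" and fB: "finite B" and AV: "A \<subseteq> V"
        using fS B less.prems finite_subset[of B S] by (auto simp: A_def)
      have L'1: "int k - d B v \<le> int (card (L' v))" "card (L' v) \<le> k" "finite (L' v)" if "v \<in> A" for v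
      proof -
        have "card (b ` (R `` {v} \<inter> B)) \<le> card (R `` {v} \<inter> B)" using fB by (intro card_image_le) auto
        moreover have "card (K v) - card (b ` (R `` {v} \<inter> B)) \<le> card (L' v)"
          unfolding L'_def using fB by (intro diff_card_le_card_Diff) auto
        ultimately show "int k - d B v \<le> int (card (L' v))" using K[of v] that AV by (auto simp: d_def)
        show "card (L' v) \<le> k" "finite (L' v)" unfolding L'_def using K[of v] that AV
          by (auto intro: order_trans[OF card_mono])
      qed
      have main: "(\<Sum>v\<in>C. d C v) < (\<Sum>v\<in>C. a * int (card (L' v)) - (a - 2) * d A v)" if C: "C \<subseteq> A" "C \<noteq> {}" for C
      proof -
        \<comment> \<open>By maximality the value of \<open>g\<close> drops below 0 when
          \<open>C\<close> is added; the inequality \<open>main\<close> is this drop, rewritten with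
          \<open>sum_degrees_remove\<close>.\<close>
        have "B \<union> C \<notin> ?F" using Bmax[of "B \<union> C"] C by (auto simp: A_def)
        then have "g (B \<union> C) < g B" using B C by (auto simp: A_def)
        moreover have "(\<Sum>v\<in>B \<union> C. d S v - int k) = (\<Sum>v\<in>B. d S v - int k) + (\<Sum>v\<in>C. d S v - int k)"
          using C fA fB by (intro sum.union_disjoint) (auto simp: A_def finite_subset)
        moreover have "S - (B \<union> C) = A - C" by (auto simp: A_def)
        ultimately have 1: "a * (\<Sum>v\<in>C. d S v - int k) + (\<Sum>v\<in>A - C. d (A - C) v) < (\<Sum>v\<in>A. d A v)"
          by (simp add: g_def A_def[symmetric] algebra_simps)
        have "int ((\<Sum>v\<in>A. card (R `` {v} \<inter> A)) + (\<Sum>v\<in>C. card (R `` {v} \<inter> C))) =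
          int ((\<Sum>v\<in>A - C. card (R `` {v} \<inter> (A - C))) + 2 * (\<Sum>v\<in>C. card (R `` {v} \<inter> A)))"
          using sum_degrees_remove[OF fA C(1) symR] by simp
        then have 2: "(\<Sum>v\<in>A. d A v) + (\<Sum>v\<in>C. d C v) = (\<Sum>v\<in>A - C. d (A - C) v) + 2 * (\<Sum>v\<in>C. d A v)"
          by (simp add: d_def)
        have "(\<Sum>v\<in>C. 2 * d A v - a * (d S v - int k)) = 2 * (\<Sum>v\<in>C. d A v) - a * (\<Sum>v\<in>C. d S v - int k)"
          unfolding sum_subtractf[of "\<lambda>v. 2 * d A v"] sum_distrib_left[symmetric] ..
        then have "(\<Sum>v\<in>C. d C v) < (\<Sum>v\<in>C. 2 * d A v - a * (d S v - int k))"
          using 1 2 by linarith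
        \<comment> \<open>A vertex loses at most \<open>d B v\<close> of its \<open>k\<close>
          colours, hence \<open>k - d S v \<le> card (L' v) - d A v\<close>.\<close>
        also have "\<dots> \<le> (\<Sum>v\<in>C. a * int (card (L' v)) - (a - 2) * d A v)"
        proof (rule sum_mono)
          fix v assume v: "v \<in> C"
          have "d S v = d A v + d B v" unfolding d_def A_def
            using card_Image_split[of S B R v] fS B by auto
          moreover have "a * (int k - d B v) \<le> a * int (card (L' v))"
            using L'1(1)[of v] v C a by (intro mult_left_mono) auto
          ultimately show "2 * d A v - a * (d S v - int k) \<le> a * int (card (L' v)) - (a - 2) * d A v"
            by (simp add: algebra_simps)
        qed
        finally show ?thesis .
      qed
      \<comment> \<open>For \<open>C = {v}\<close> an empty list would push the right-hand side of
        \<open>main\<close> down to at most 0.\<close>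
      have "L' v \<noteq> {}" if "v \<in> A" for v
      proof
        assume "L' v = {}"
        then have "d {v} v < - ((a - 2) * d A v)" using main[of "{v}"] that by simp
        moreover have "0 \<le> (a - 2) * d A v" "0 \<le> d {v} v" using a by (simp_all add: d_def)
        ultimately show False by linarith
      qed
      then have "list_graph A (R \<inter> A \<times> A) L'"
        using fA L'1(3) symR irR by unfold_locales (auto simp: sym_def irrefl_def)
      moreover have "slack a A (R \<inter> A \<times> A) L'"
        unfolding slack_def
      proof (intro allI impI)
        fix C assume C: "C \<subseteq> A" "C \<noteq> {}"
        have "(R \<inter> A \<times> A) `` {v} \<inter> C = R `` {v} \<inter> C" "(R \<inter> A \<times> A) `` {v} = R `` {v} \<inter> A" if "v \<in> C" for v
          using C that by auto
        then show "(\<Sum>v\<in>C. int (card ((R \<inter> A \<times> A) `` {v} \<inter> C))) <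
          (\<Sum>v\<in>C. a * int (card (L' v)) - (a - 2) * int (card ((R \<inter> A \<times> A) `` {v})))"
          using main[OF C] by (simp add: d_def)
      qed
      ultimately obtain h where h: "\<forall>v\<in>A. h v \<in> L' v" "clustered (R \<inter> A \<times> A) A h c"
        using ext L'1(2) by blast
      have "clustered R (B \<union> A) (\<lambda>v. if v \<in> B then b v else h v) c"
        using h b(2) symR by (intro clustered_join) (auto simp: A_def L'_def)
      moreover have "B \<union> A = S" using B by (auto simp: A_def)
      ultimately show ?thesis using b(1) h(1)
        by (intro exI[of _ "\<lambda>v. if v \<in> B then b v else h v"]) (auto simp: L'_def)
    qed
  qed
  then show ?thesis using K by (meson order_refl subsetD)
qed

subsection \<open>Paths and cycles\<close>

locale max_deg2 =
  fixes V :: "'a set" and M :: "('a \<times> 'a) set"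
  assumes finite_V: "finite V" and M_sub: "M \<subseteq> V \<times> V" and sym_M: "sym M" and irrefl_M: "irrefl M"
    and deg2: "v \<in> V \<Longrightarrow> card (M `` {v}) \<le> 2"
begin

definition mpath :: "'a list \<Rightarrow> bool" where
  "mpath xs \<longleftrightarrow> xs \<noteq> [] \<and> distinct xs \<and> set xs \<subseteq> V \<and> (\<forall>i. Suc i < length xs \<longrightarrow> (xs ! i, xs ! Suc i) \<in> M)"

text \<open>Paths and cycles share one encoding: the list runs through a whole component, and on a
  cycle its last vertex happens to be adjacent to its first.\<close>

definition full_path :: "'a list \<Rightarrow> bool" where
  "full_path xs \<longleftrightarrow> mpath xs \<and> (\<forall>x\<in>set xs. M `` {x} \<subseteq> set xs)"

lemma M_symD: "(x, y) \<in> M \<Longrightarrow> (y, x) \<in> M"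
  using sym_M by (rule symD)

lemma finite_nbrs: "finite (M `` {v})"
  using M_sub finite_V by (auto intro: finite_subset)

lemma interior_nbrs:
  assumes "mpath xs" "0 < i" "Suc i < length xs"
  shows "M `` {xs ! i} = {xs ! (i - 1), xs ! Suc i}"
proof -
  have step: "(xs ! j, xs ! Suc j) \<in> M" if "Suc j < length xs" for j
    using assms(1) that by (simp add: mpath_def)
  have "(xs ! (i - 1), xs ! Suc (i - 1)) \<in> M" "(xs ! i, xs ! Suc i) \<in> M"
    using assms(2,3) step[of "i - 1"] step[of i] by simp_all
  then have sub: "{xs ! (i - 1), xs ! Suc i} \<subseteq> M `` {xs ! i}"
    using assms(2) M_symD[of "xs ! (i - 1)" "xs ! i"] by simp
  have ne: "xs ! (i - 1) \<noteq> xs ! Suc i"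
    using assms by (simp add: mpath_def nth_eq_iff_index_eq)
  have "xs ! i \<in> V" using assms by (auto simp: mpath_def)
  then have "card (M `` {xs ! i}) \<le> card {xs ! (i - 1), xs ! Suc i}" using deg2[of "xs ! i"] ne by simp
  then show ?thesis using card_seteq[OF finite_nbrs sub] by simp
qed

text \<open>A longest path through \<open>v\<close> works: a neighbour outside it would extend it at
  an end, and an inner vertex already has both its neighbours on it.\<close>

lemma full_path_exists:
  assumes "v \<in> V"
  shows "\<exists>xs. full_path xs \<and> v \<in> set xs"
proof -
  let ?P = "\<lambda>xs. mpath xs \<and> v \<in> set xs"
  have bound: "length xs \<le> card V" if "mpath xs" for xs
    using that finite_V by (metis card_mono distinct_card mpath_def)
  have "?P [v]" using assms by (simp add: mpath_def)
  then have "\<exists>xs. ?P xs \<and> (\<forall>ys. ?P ys \<longrightarrow> length ys \<le> length xs)"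
    using bound by (intro Lattices_Big.ex_has_greatest_nat[where b="Suc (card V)" and k="[v]"]) (simp_all add: less_Suc_eq_le)
  then obtain xs where xs: "mpath xs" "v \<in> set xs" and mx: "\<And>ys. ?P ys \<Longrightarrow> length ys \<le> length xs"
    by metis
  have "M `` {xs ! i} \<subseteq> set xs" if i: "i < length xs" for i
  proof (rule ccontr)
    assume "\<not> M `` {xs ! i} \<subseteq> set xs"
    then obtain y where y: "(xs ! i, y) \<in> M" "y \<notin> set xs" by blast
    then have yV: "y \<in> V" using M_sub by blast
    consider "i = 0" | "Suc i = length xs" | "0 < i" "Suc i < length xs" using i by linarith
    then show False
    proof cases
      case 1
      have "(y, xs ! 0) \<in> M" using y(1) 1 M_symD by simp
      then have "mpath (y # xs)" using xs(1) y(2) yV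
        by (auto simp: mpath_def nth_Cons split: nat.splits)
      then show False using mx[of "y # xs"] xs(2) by simp
    next
      case 2
      have "mpath (xs @ [y])" unfolding mpath_def
      proof (intro conjI allI impI)
        fix j assume j: "Suc j < length (xs @ [y])"
        show "((xs @ [y]) ! j, (xs @ [y]) ! Suc j) \<in> M"
        proof (cases "Suc j < length xs")
          case True then show ?thesis using xs(1) by (simp add: mpath_def nth_append)
        next
          case False
          then have "Suc j = length xs" "j = i" using j 2 by auto
          then show ?thesis using y(1) i by (simp add: nth_append)
        qed
      qed (use xs(1) y(2) yV in \<open>auto simp: mpath_def\<close>)
      then show False using mx[of "xs @ [y]"] xs(2) by simp
    next
      case 3
      have "y \<in> {xs ! (i - 1), xs ! Suc i}" using interior_nbrs[OF xs(1) 3] y(1) by blast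
      then show False using y(2) 3 by auto
    qed
  qed
  then have "full_path xs" using xs(1) unfolding full_path_def by (metis in_set_conv_nth)
  then show ?thesis using xs(2) by blast
qed

lemma set_full_path:
  assumes "full_path xs" "v \<in> set xs"
  shows "set xs = M\<^sup>* `` {v}"
proof
  have 0: "(xs ! 0, xs ! i) \<in> M\<^sup>*" if "i < length xs" for i
    using that
  proof (induction i)
    case (Suc i)
    then show ?case using assms(1) unfolding full_path_def mpath_def
      by (metis Suc_lessD rtrancl.rtrancl_into_rtrancl)
  qed simp
  have symr: "sym (M\<^sup>*)" using sym_M by (rule sym_rtrancl)
  show "set xs \<subseteq> M\<^sup>* `` {v}"
  proof
    fix y assume "y \<in> set xs"
    then obtain i j where "i < length xs" "xs ! i = y" "j < length xs" "xs ! j = v"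
      using assms(2) by (metis in_set_conv_nth)
    then have "(v, xs ! 0) \<in> M\<^sup>*" "(xs ! 0, y) \<in> M\<^sup>*" using 0 symD[OF symr] by blast+
    then show "y \<in> M\<^sup>* `` {v}" by (simp add: rtrancl_trans)
  qed
  have "y \<in> set xs" if "(v, y) \<in> M\<^sup>*" for y
    using that by (induction rule: rtrancl_induct) (use assms full_path_def in \<open>auto\<close>)
  then show "M\<^sup>* `` {v} \<subseteq> set xs" by blast
qed

lemma full_path_adjacent:
  assumes "full_path xs" "i < length xs" "j < length xs" "(xs ! i, xs ! j) \<in> M"
  shows "j = Suc i \<or> i = Suc j \<or> (i = 0 \<and> j = length xs - 1) \<or> (j = 0 \<and> i = length xs - 1)"
proof -
  have m: "mpath xs" "distinct xs" using assms(1) by (auto simp: full_path_def mpath_def)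
  have int: "l = Suc k \<or> k = Suc l" if "0 < k" "Suc k < length xs" "l < length xs" "(xs ! k, xs ! l) \<in> M" for k l
  proof -
    have "xs ! l = xs ! (k - 1) \<or> xs ! l = xs ! Suc k" using interior_nbrs[OF m(1) that(1,2)] that(4) by blast
    then show ?thesis using m(2) that by (auto simp: nth_eq_iff_index_eq)
  qed
  have "i \<noteq> j" using assms(4) irrefl_M by (auto simp: irrefl_def)
  consider "0 < i" "Suc i < length xs" | "0 < j" "Suc j < length xs"
    | "i = 0 \<or> i = length xs - 1" "j = 0 \<or> j = length xs - 1"
    using assms(2,3) by linarith
  then show ?thesis
  proof cases
    case 1 then show ?thesis using int[of i j] assms(3,4) by blast
  next
    case 2 then show ?thesis using int[of j i] assms(2) M_symD[OF assms(4)] by blast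
  next
    case 3 then show ?thesis using \<open>i \<noteq> j\<close> by blast
  qed
qed

lemma card_le1_end:
  assumes "full_path xs" "i < length xs" "card (M `` {xs ! i}) \<le> 1"
  shows "i = 0 \<or> i = length xs - 1"
proof (rule ccontr)
  assume "\<not> ?thesis"
  then have i: "0 < i" "Suc i < length xs" using assms(2) by linarith+
  have m: "mpath xs" "distinct xs" using assms(1) by (auto simp: full_path_def mpath_def)
  have "xs ! (i - 1) \<noteq> xs ! Suc i" using m(2) i by (simp add: nth_eq_iff_index_eq)
  then show False using assms(3) interior_nbrs[OF m(1) i] by simp
qed

text \<open>Vertices of degree at most 1 stand only at the two ends of the list. The bound limits
  the conflicts in which the end of a component can be involved.\<close>

lemma other_end_unique:
  assumes "x \<in> V" "card (M `` {x}) \<le> 1"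
  shows "\<exists>y0. {y. (x, y) \<in> M\<^sup>* \<and> y \<noteq> x \<and> card (M `` {y}) \<le> 1} \<subseteq> {y0}"
proof -
  obtain xs where xs: "full_path xs" "x \<in> set xs" using full_path_exists[OF assms(1)] by blast
  then obtain i where i: "i < length xs" "x = xs ! i" by (metis in_set_conv_nth)
  have ie: "i = 0 \<or> i = length xs - 1" using card_le1_end[OF xs(1) i(1)] assms(2) i(2) by simp
  have "y = xs ! (length xs - 1 - i)" if y: "(x, y) \<in> M\<^sup>*" "y \<noteq> x" "card (M `` {y}) \<le> 1" for y
  proof -
    have "y \<in> set xs" using set_full_path[OF xs] y(1) by blast
    then obtain j where j: "j < length xs" "y = xs ! j" by (metis in_set_conv_nth)
    have "j = 0 \<or> j = length xs - 1" using card_le1_end[OF xs(1) j(1)] y(3) j(2) by simp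
    moreover have "j \<noteq> i" using y(2) i(2) j(2) by blast
    ultimately have "j = length xs - 1 - i" using ie by auto
    then show ?thesis using j(2) by simp
  qed
  then show ?thesis by blast
qed

section \<open>Cutting paths and cycles into pieces\<close>

definition reach_avoiding :: "'a set \<Rightarrow> 'a \<Rightarrow> 'a set" where
  "reach_avoiding T x = (M \<inter> (- T) \<times> (- T))\<^sup>* `` {x}"

lemma card_reach_avoiding_le:
  assumes fp: "full_path xs" and X: "X \<subseteq> {..<length xs}" "i \<in> X"
    and cl: "\<And>j k. j \<in> X \<Longrightarrow> k < length xs \<Longrightarrow> (xs ! j, xs ! k) \<in> M \<Longrightarrow> xs ! k \<notin> T \<Longrightarrow> k \<in> X"
  shows "card (reach_avoiding T (xs ! i)) \<le> card X"
proof -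
  have "y \<in> (!) xs ` X" if "(xs ! i, y) \<in> (M \<inter> (- T) \<times> (- T))\<^sup>*" for y
    using that
  proof (induction rule: rtrancl_induct)
    case base then show ?case using X(2) by simp
  next
    case (step y z)
    then obtain j where j: "j \<in> X" "y = xs ! j" by blast
    have "y \<in> set xs" using j X(1) by auto
    then have "z \<in> set xs" using fp step(2) by (auto simp: full_path_def)
    then obtain k where "k < length xs" "z = xs ! k" by (metis in_set_conv_nth)
    then show ?case using cl[OF j(1)] step(2) j(2) by auto
  qed
  then have "reach_avoiding T (xs ! i) \<subseteq> (!) xs ` X" unfolding reach_avoiding_def by blast
  moreover have fX: "finite X" using X(1) finite_subset by blast
  ultimately have "card (reach_avoiding T (xs ! i)) \<le> card ((!) xs ` X)" by (intro card_mono) auto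
  also have "\<dots> \<le> card X" using fX by (rule card_image_le)
  finally show ?thesis .
qed

text \<open>The blocks of a path or cycle with \<open>p\<close> vertices are runs of \<open>s\<close> interior vertices, separated by
  single vertices; the vertices left over are shared out evenly between the two ends.\<close>

definition num_blocks :: "nat \<Rightarrow> nat \<Rightarrow> nat" where
  "num_blocks s p = (p - 2) div (s + 1)"

definition block_start :: "nat \<Rightarrow> nat \<Rightarrow> nat \<Rightarrow> nat" where
  "block_start s p i = 1 + ((p - 2) mod (s + 1)) div 2 + i * (s + 1)"

definition block :: "nat \<Rightarrow> 'a list \<Rightarrow> nat \<Rightarrow> 'a set" where
  "block s xs i = (!) xs ` {block_start s (length xs) i..<block_start s (length xs) i + s}"

lemma block_start_Suc: "block_start s p (Suc i) = block_start s p i + s + 1"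
  by (simp add: block_start_def)

lemma block_start_mono:
  assumes "i < j"
  shows "block_start s p i + s + 1 \<le> block_start s p j"
proof -
  have "Suc i * (s + 1) \<le> j * (s + 1)" using assms by (intro mult_right_mono) auto
  then show ?thesis by (simp add: block_start_def)
qed

text \<open>At most \<open>s\<close> positions are left over by the blocks. With half of them at
  each end, an end part has at most \<open>3 * (s + 1) / 2\<close> positions instead of about
  \<open>2 * s\<close>. The last bound is for cycles, where both end parts form one piece.\<close>

lemma block_start_last:
  assumes "0 < num_blocks s p"
  shows "2 * (p - 1 - block_start s p (num_blocks s p - 1)) \<le> 3 * (s + 1)"
    "block_start s p (num_blocks s p - 1) + s < p - 1"
    "2 * (block_start s p 0 + s) \<le> 3 * (s + 1)"
    "block_start s p 0 + s + (p - 1 - block_start s p (num_blocks s p - 1)) \<le> 3 * s + 2"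
proof -
  let ?P = "s + 1" and ?q = "num_blocks s p"
  define rem where "rem = (p - 2) mod ?P"
  have rem: "rem \<le> s" using mod_less_divisor[of ?P "p - 2"] by (simp add: rem_def)
  have half: "2 * (rem div 2) \<le> rem" "rem \<le> 2 * (rem div 2) + 1" by presburger+
  have p: "p - 2 = ?q * ?P + rem" unfolding num_blocks_def rem_def by (rule div_mult_mod_eq[symmetric])
  have q: "?q * ?P = (?q - 1) * ?P + ?P" using assms by (metis Suc_diff_1 add.commute mult_Suc)
  have b: "block_start s p i = 1 + rem div 2 + i * ?P" for i by (simp add: block_start_def rem_def)
  have p2: "p = (?q - 1) * ?P + ?P + rem + 2" using p q by linarith
  have e1: "p - 1 - block_start s p (?q - 1) = ?P + rem - rem div 2" using p2 b[of "?q - 1"] half by linarith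
  have "2 * (m - h) \<le> 3 * ?P" if "h \<le> rem" "m = ?P + rem" "rem \<le> 2 * h + 1" for m h
    using that rem by simp
  then show "2 * (p - 1 - block_start s p (?q - 1)) \<le> 3 * ?P" unfolding e1 using half by simp
  show "block_start s p (?q - 1) + s < p - 1" using p2 b[of "?q - 1"] half by linarith
  show "2 * (block_start s p 0 + s) \<le> 3 * ?P" using b[of 0] rem half by simp
  show "block_start s p 0 + s + (p - 1 - block_start s p (?q - 1)) \<le> 3 * s + 2"
    unfolding e1 using b[of 0] rem half by simp
qed

lemma block_index:
  assumes "i < num_blocks s (length xs)"
    "k \<in> {block_start s (length xs) i..<block_start s (length xs) i + s}"
  shows "0 < k" "Suc k < length xs"
proof -
  have q: "0 < num_blocks s (length xs)" using assms(1) by simp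
  show "0 < k" using assms(2) by (simp add: block_start_def)
  have "block_start s (length xs) i \<le> block_start s (length xs) (num_blocks s (length xs) - 1)"
  proof (cases "i = num_blocks s (length xs) - 1")
    case False
    then have "i < num_blocks s (length xs) - 1" using assms(1) by linarith
    from block_start_mono[OF this, of s "length xs"] show ?thesis by linarith
  qed simp
  then show "Suc k < length xs" using block_start_last(2)[OF q] assms(2) unfolding atLeastLessThan_iff by linarith
qed

text \<open>The last bound counts the \<open>s - 1\<close> edges along the block twice. It bounds
  the left side of the slack inequality for the block from below, which is the source of the many
  switches.\<close>

lemma block_facts:
  assumes fp: "full_path xs" and i: "i < num_blocks s (length xs)"
  shows "block s xs i \<subseteq> set xs" "card (block s xs i) = s"
    "x \<in> block s xs i \<Longrightarrow> card (M `` {x}) = 2"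
    "2 * (s - 1) \<le> (\<Sum>x\<in>block s xs i. card (M `` {x} \<inter> block s xs i))"
proof -
  define b where "b = block_start s (length xs) i"
  have d: "mpath xs" "distinct xs" using fp by (auto simp: full_path_def mpath_def)
  have bl: "block s xs i = (!) xs ` {b..<b + s}" by (simp add: block_def b_def)
  have k: "0 < k \<and> Suc k < length xs" if "k \<in> {b..<b + s}" for k
    using block_index[OF i] that by (simp add: b_def)
  then have inj: "inj_on ((!) xs) {b..<b + s}"
    using nth_eq_iff_index_eq[OF d(2)] by (meson Suc_lessD inj_onI)
  show "block s xs i \<subseteq> set xs" using k Suc_lessD nth_mem unfolding bl by blast
  show "card (block s xs i) = s" using inj by (simp add: bl card_image)
  show "card (M `` {x}) = 2" if x: "x \<in> block s xs i"
  proof -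
    obtain j where j: "j \<in> {b..<b + s}" "x = xs ! j" using x bl by blast
    have kj: "0 < j" "Suc j < length xs" "j - 1 < length xs" using k[OF j(1)] by auto
    then have "xs ! (j - 1) \<noteq> xs ! Suc j" using nth_eq_iff_index_eq[OF d(2), of "j - 1" "Suc j"] by simp
    moreover have "M `` {xs ! j} = {xs ! (j - 1), xs ! Suc j}"
      by (rule interior_nbrs[OF d(1) kj(1,2)])
    ultimately show ?thesis using j(2) by simp
  qed
  \<comment> \<open>Each position contributes its predecessor and its successor, except that the
    first and the last position of the block lack one of them.\<close>
  have "2 * (s - 1) = (\<Sum>j\<in>{b..<b + s}. (if j = b then 0 else 1) + (if j = b + s - 1 then 0 else 1))"
  proof (cases "s = 0")
    case False
    have "(\<Sum>j\<in>{b..<b + s}. if j = a then 0 else 1) = s - 1" if "a \<in> {b..<b + s}" for a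
    proof -
      have "(\<Sum>j\<in>{b..<b + s}. if j = a then 0 else (1::nat)) = card ({b..<b + s} - {a})"
        using that by (simp add: sum.remove[of _ a])
      then show ?thesis using that by simp
    qed
    from this[of b] this[of "b + s - 1"] False show ?thesis by (simp add: sum.distrib)
  qed simp
  also have "\<dots> \<le> (\<Sum>j\<in>{b..<b + s}. card (M `` {xs ! j} \<inter> block s xs i))"
  proof (rule sum_mono)
    fix j assume j: "j \<in> {b..<b + s}"
    have kj: "0 < j" "Suc j < length xs" "j - 1 < length xs" using k[OF j] by auto
    have nb: "M `` {xs ! j} = {xs ! (j - 1), xs ! Suc j}" by (rule interior_nbrs[OF d(1) kj(1,2)])
    have ne: "xs ! (j - 1) \<noteq> xs ! Suc j"
      using kj nth_eq_iff_index_eq[OF d(2), of "j - 1" "Suc j"] by simp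
    define X where "X = (if j = b then {} else {xs ! (j - 1)}) \<union> (if j = b + s - 1 then {} else {xs ! Suc j})"
    have "j = b \<or> j - 1 \<in> {b..<b + s}" "j = b + s - 1 \<or> Suc j \<in> {b..<b + s}" using j by auto
    then have "X \<subseteq> M `` {xs ! j} \<inter> block s xs i" unfolding X_def nb bl by auto
    then have "card X \<le> card (M `` {xs ! j} \<inter> block s xs i)" using finite_nbrs by (intro card_mono) auto
    then show "(if j = b then 0 else 1) + (if j = b + s - 1 then 0 else 1) \<le> card (M `` {xs ! j} \<inter> block s xs i)"
      using ne by (auto simp: X_def split: if_splits)
  qed
  also have "\<dots> = (\<Sum>x\<in>block s xs i. card (M `` {x} \<inter> block s xs i))"
    using inj by (simp add: bl sum.reindex)
  finally show "2 * (s - 1) \<le> (\<Sum>x\<in>block s xs i. card (M `` {x} \<inter> block s xs i))" .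
qed

text \<open>A single vertex lies between consecutive blocks, and the closing edge of a cycle joins
  the two end vertices, which belong to no block.\<close>

lemma blocks_separated:
  assumes fp: "full_path xs" and ij: "i < num_blocks s (length xs)" "j < num_blocks s (length xs)" "i \<noteq> j"
    and xy: "x \<in> block s xs i" "y \<in> block s xs j"
  shows "x \<noteq> y" "(x, y) \<notin> M"
proof -
  have d: "distinct xs" using fp by (auto simp: full_path_def mpath_def)
  obtain k l where k: "k \<in> {block_start s (length xs) i..<block_start s (length xs) i + s}" "x = xs ! k"
    and l: "l \<in> {block_start s (length xs) j..<block_start s (length xs) j + s}" "y = xs ! l"
    using xy unfolding block_def by blast
  note kl = block_index[OF ij(1) k(1)] block_index[OF ij(2) l(1)]
  have far: "Suc k < l \<or> Suc l < k"
    using block_start_mono[of i j s "length xs"] block_start_mono[of j i s "length xs"] ij(3) k(1) l(1)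
    by (cases "i < j") auto
  show "x \<noteq> y" using far k(2) l(2) kl d by (auto simp: nth_eq_iff_index_eq)
  show "(x, y) \<notin> M"
  proof
    assume "(x, y) \<in> M"
    then have "l = Suc k \<or> k = Suc l \<or> (k = 0 \<and> l = length xs - 1) \<or> (l = 0 \<and> k = length xs - 1)"
      using full_path_adjacent[OF fp, of k l] k(2) l(2) kl by simp
    then show False using far kl by auto
  qed
qed

text \<open>Between hits in consecutive blocks lie at most \<open>2 * s\<close> vertices. The first
  bound is larger because a cycle joins the parts before the first and after the last hit. At the
  end of a path only one of these parts counts, which gives the second bound; switched vertices
  attach only there.\<close>

lemma card_piece:
  assumes fp: "full_path xs" and s: "0 < s"
    and T: "\<And>i. i < num_blocks s (length xs) \<Longrightarrow> T \<inter> block s xs i \<noteq> {}"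
    and x: "x \<in> set xs" "x \<notin> T"
  shows "card (reach_avoiding T x) \<le> 3 * s + 1 \<and>
         (card (M `` {x}) \<le> 1 \<longrightarrow> 2 * card (reach_avoiding T x) \<le> 3 * (s + 1))"
proof -
  define p where "p = length xs"
  define q where "q = num_blocks s p"
  have d: "distinct xs" "mpath xs" using fp by (auto simp: full_path_def mpath_def)
  obtain j where j: "j < p" "x = xs ! j" using x(1) by (metis in_set_conv_nth p_def)
  have adj: "l = Suc k \<or> k = Suc l \<or> (k = 0 \<and> l = p - 1) \<or> (l = 0 \<and> k = p - 1)"
    if "k < p" "l < p" "(xs ! k, xs ! l) \<in> M" for k l
    using full_path_adjacent[OF fp, of k l] that by (simp add: p_def)
  note reach = card_reach_avoiding_le[OF fp, folded p_def]
  show ?thesis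
  proof (cases "q = 0")
    case True
    have "p - 2 < s + 1"
      using True by (simp add: q_def num_blocks_def div_eq_0_iff)
    moreover have "card (reach_avoiding T x) \<le> card {..<p}"
      unfolding j(2) by (rule reach) (use j in auto)
    ultimately have "card (reach_avoiding T x) \<le> s + 2" by simp
    then have "card (reach_avoiding T x) \<le> 3 * s + 1" "2 * card (reach_avoiding T x) \<le> 3 * (s + 1)"
      using s by simp_all
    then show ?thesis by blast
  next
    case False
    then have q0: "0 < num_blocks s p" by (simp add: q_def)
    have "\<exists>k. k \<in> {block_start s p i..<block_start s p i + s} \<and> xs ! k \<in> T" if "i < q" for i
      using T[of i] that by (auto simp: q_def p_def block_def)
    then obtain t where t: "\<And>i. i < q \<Longrightarrow> t i \<in> {block_start s p i..<block_start s p i + s}"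
      "\<And>i. i < q \<Longrightarrow> xs ! t i \<in> T" by metis
    have tp: "0 < t i" "Suc (t i) < p" if "i < q" for i
      using block_index[of i s xs "t i"] t(1)[OF that] that by (simp_all add: q_def p_def)
    have jt: "j \<noteq> t i" if "i < q" for i using t(2)[OF that] x(2) j(2) by auto
    have t0: "t 0 < block_start s p 0 + s" using t(1)[of 0] False by simp
    have tq: "block_start s p (q - 1) \<le> t (q - 1)" using t(1)[of "q - 1"] False by simp
    note last = block_start_last[OF q0, folded q_def]
    show ?thesis
    proof (cases "j < t 0 \<or> t (q - 1) < j")
      case True
      let ?X = "{..<t 0} \<union> {t (q - 1)<..<p}"
      have "card (reach_avoiding T x) \<le> card ?X"
        unfolding j(2)
      proof (rule reach)
        fix a b assume ab: "a \<in> ?X" "b < p" "(xs ! a, xs ! b) \<in> M" "xs ! b \<notin> T"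
        have "b \<noteq> t 0" "b \<noteq> t (q - 1)" using ab(4) t(2) False by auto
        moreover have "a < p" using ab(1) tp(2)[of 0] False by auto
        ultimately show "b \<in> ?X" using adj[OF _ ab(2,3)] ab(1,2) tp[of 0] tp[of "q - 1"] False by auto
      qed (use True j tp[of 0] False in auto)
      also have "\<dots> \<le> t 0 + (p - 1 - t (q - 1))"
        using card_Un_le[of "{..<t 0}" "{t (q - 1)<..<p}"] by simp
      also have "\<dots> \<le> 3 * s + 1" using t0 tq last(4) by linarith
      finally have 1: "card (reach_avoiding T x) \<le> 3 * s + 1" .
      have "2 * card (reach_avoiding T x) \<le> 3 * (s + 1)" if c: "card (M `` {x}) \<le> 1"
      proof -
        have e: "j = 0 \<or> j = p - 1" using card_le1_end[OF fp] c j by (simp add: p_def)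
        have p3: "2 < p" using tp[of 0] False by linarith
        \<comment> \<open>An edge between the ends would give \<open>x\<close>, which is one of
          them, two distinct neighbours.\<close>
        have noloop: "(xs ! 0, xs ! (p - 1)) \<notin> M"
        proof
          assume a: "(xs ! 0, xs ! (p - 1)) \<in> M"
          have step: "(xs ! k, xs ! Suc k) \<in> M" if "Suc k < p" for k
            using d(2) that by (simp add: mpath_def p_def)
          have "Suc (p - 2) = p - 1" using p3 by simp
          then have m: "(xs ! 0, xs ! 1) \<in> M" "(xs ! (p - 2), xs ! (p - 1)) \<in> M"
            using p3 step[of 0] step[of "p - 2"] by simp_all
          have n: "xs ! 1 \<noteq> xs ! (p - 1)" "xs ! 0 \<noteq> xs ! (p - 2)"
            using nth_eq_iff_index_eq[OF d(1), folded p_def, of 1 "p - 1"]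
              nth_eq_iff_index_eq[OF d(1), folded p_def, of 0 "p - 2"] p3 by simp_all
          have "\<exists>y z. y \<noteq> z \<and> {y, z} \<subseteq> M `` {x}"
            using e a m n M_symD j(2) by (metis Image_singleton_iff empty_subsetI insert_subset)
          then obtain y z where yz: "y \<noteq> z" "{y, z} \<subseteq> M `` {x}" by blast
          then have "card {y, z} \<le> card (M `` {x})" using finite_nbrs by (intro card_mono)
          then show False using c yz(1) by simp
        qed
        show ?thesis
        proof (cases "j = 0")
          case True
          have "card (reach_avoiding T x) \<le> card {..<t 0}"
            unfolding j(2)
          proof (rule reach)
            fix a b assume ab: "a \<in> {..<t 0}" "b < p" "(xs ! a, xs ! b) \<in> M" "xs ! b \<notin> T"
            have "b \<noteq> t 0" using ab(4) t(2) False by auto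
            moreover have a: "a < p" "a \<noteq> p - 1" using ab(1) tp(2)[of 0] False by auto
            moreover have "\<not> (a = 0 \<and> b = p - 1)" using noloop ab(3) by auto
            ultimately have "b = Suc a \<or> a = Suc b" "b \<noteq> t 0" using adj[OF a(1) ab(2,3)] by auto
            then show "b \<in> {..<t 0}" using ab(1) by auto
          qed (use True tp[of 0] False in auto)
          then show ?thesis using t0 last(3) by simp
        next
          case jn: False
          then have jp: "j = p - 1" using e by simp
          have "card (reach_avoiding T x) \<le> card {t (q - 1)<..<p}"
            unfolding j(2)
          proof (rule reach)
            fix a b assume ab: "a \<in> {t (q - 1)<..<p}" "b < p" "(xs ! a, xs ! b) \<in> M" "xs ! b \<notin> T"
            have "b \<noteq> t (q - 1)" using ab(4) t(2) False by auto
            moreover have "\<not> (b = 0 \<and> a = p - 1)" using noloop M_symD[OF ab(3)] by auto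
            moreover have a: "a < p" "a \<noteq> 0" using ab(1) by auto
            ultimately have "b = Suc a \<or> a = Suc b" "b \<noteq> t (q - 1)" using adj[OF a(1) ab(2,3)] by auto
            then show "b \<in> {t (q - 1)<..<p}" using ab(1,2) by auto
          qed (use jp tp[of "q - 1"] False in auto)
          then show ?thesis using tq last(1) by simp
        qed
      qed
      then show ?thesis using 1 by blast
    next
      case mid: False
      define i where "i = Max {i. i < q \<and> t i < j}"
      have ne: "0 \<in> {i. i < q \<and> t i < j}" using mid jt[of 0] False by auto
      have fin: "finite {i. i < q \<and> t i < j}" by simp
      have "i \<in> {i. i < q \<and> t i < j}" unfolding i_def using Max_in[OF fin] ne by blast
      then have i: "i < q" "t i < j" by auto
      have "i \<noteq> q - 1" using i mid by auto
      then have Si: "Suc i < q" using i by linarith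
      have "\<not> t (Suc i) < j" using Max_ge[OF fin, of "Suc i"] Si unfolding i_def[symmetric] by auto
      then have jS: "j < t (Suc i)" using jt[OF Si] by linarith
      have "card (reach_avoiding T x) \<le> card {t i<..<t (Suc i)}"
        unfolding j(2)
      proof (rule reach)
        fix a b assume ab: "a \<in> {t i<..<t (Suc i)}" "b < p" "(xs ! a, xs ! b) \<in> M" "xs ! b \<notin> T"
        have "b \<noteq> t i" "b \<noteq> t (Suc i)" using ab(4) t(2) i Si by auto
        then show "b \<in> {t i<..<t (Suc i)}" using adj[OF _ ab(2,3)] ab(1) tp[OF i(1)] tp[OF Si] by auto
      qed (use i jS tp[OF Si] in auto)
      also have "\<dots> \<le> 2 * s"
        using t(1)[OF i(1)] t(1)[OF Si] block_start_Suc[of s p i]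
        unfolding atLeastLessThan_iff card_greaterThanLessThan by linarith
      finally have "card (reach_avoiding T x) \<le> 3 * s + 1" by simp
      moreover have "\<not> card (M `` {x}) \<le> 1"
      proof
        assume "card (M `` {x}) \<le> 1"
        then have "j = 0 \<or> j = p - 1" using card_le1_end[OF fp] j by (simp add: p_def)
        then show False using i(2) jS tp[OF Si] by auto
      qed
      ultimately show ?thesis by blast
    qed
  qed
qed

lemma block_system_exists:
  assumes s: "0 < s"
  shows "\<exists>\<B>. finite \<B> \<and> \<Union> \<B> \<subseteq> V \<and>
    (\<forall>b\<in>\<B>. card b = s \<and> (\<forall>x\<in>b. card (M `` {x}) = 2) \<and>
       2 * (s - 1) \<le> (\<Sum>x\<in>b. card (M `` {x} \<inter> b))) \<and>
    (\<forall>b\<in>\<B>. \<forall>b'\<in>\<B>. b \<noteq> b' \<longrightarrow> (\<forall>x\<in>b. \<forall>y\<in>b'. x \<noteq> y \<and> (x, y) \<notin> M)) \<and>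
    (\<forall>T. (\<forall>b\<in>\<B>. T \<inter> b \<noteq> {}) \<longrightarrow> (\<forall>x\<in>V - T. card (reach_avoiding T x) \<le> 3 * s + 1 \<and>
       (card (M `` {x}) \<le> 1 \<longrightarrow> 2 * card (reach_avoiding T x) \<le> 3 * (s + 1))))"
proof -
  define K where "K v = M\<^sup>* `` {v}" for v
  have "\<forall>k\<in>K ` V. \<exists>xs. full_path xs \<and> set xs = k"
    using full_path_exists set_full_path by (auto simp: K_def) metis
  \<comment> \<open>One list is fixed per component and not per vertex, since blocks cut from
    different listings of the same component could overlap.\<close>
  then obtain pl where pl: "\<And>k. k \<in> K ` V \<Longrightarrow> full_path (pl k) \<and> set (pl k) = k" by metis
  define \<B> where "\<B> = (\<Union>k\<in>K ` V. block s (pl k) ` {..<num_blocks s (length (pl k))})"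
  have BE: "\<exists>k i. k \<in> K ` V \<and> i < num_blocks s (length (pl k)) \<and> b = block s (pl k) i" if "b \<in> \<B>" for b
    using that by (auto simp: \<B>_def)
  have symr: "sym (M\<^sup>*)" using sym_M by (rule sym_rtrancl)
  have Keq: "k = k'" if k: "k \<in> K ` V" "k' \<in> K ` V" "x \<in> k" "y \<in> k'" "(x, y) \<in> M\<^sup>*" for k k' x y
  proof -
    obtain v v' where v: "k = K v" "k' = K v'" using k by blast
    have "(v, v') \<in> M\<^sup>*" using k v symD[OF symr, of v' y] unfolding K_def by (meson Image_singleton_iff rtrancl_trans)
    then have "K v = K v'" unfolding K_def using symD[OF symr] by (auto intro: rtrancl_trans)
    then show ?thesis using v by simp
  qed
  have fin: "finite \<B>" using finite_V by (simp add: \<B>_def)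
  have blk: "b \<subseteq> V \<and> card b = s \<and> (\<forall>x\<in>b. card (M `` {x}) = 2) \<and>
       2 * (s - 1) \<le> (\<Sum>x\<in>b. card (M `` {x} \<inter> b))" if "b \<in> \<B>" for b
  proof -
    obtain k i where k: "k \<in> K ` V" and i: "i < num_blocks s (length (pl k))" and b: "b = block s (pl k) i"
      using BE[OF \<open>b \<in> \<B>\<close>] by metis
    have fp: "full_path (pl k)" using pl[OF k] by simp
    then have "set (pl k) \<subseteq> V" by (simp add: full_path_def mpath_def)
    then show ?thesis using block_facts[OF fp i] b by auto
  qed
  have sep: "x \<noteq> y \<and> (x, y) \<notin> M" if "b \<in> \<B>" "b' \<in> \<B>" "b \<noteq> b'" "x \<in> b" "y \<in> b'" for b b' x y
  proof -
    obtain k i where k: "k \<in> K ` V" and i: "i < num_blocks s (length (pl k))" and b: "b = block s (pl k) i"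
      using BE[OF \<open>b \<in> \<B>\<close>] by metis
    obtain k' i' where k': "k' \<in> K ` V" and i': "i' < num_blocks s (length (pl k'))" and b': "b' = block s (pl k') i'"
      using BE[OF \<open>b' \<in> \<B>\<close>] by metis
    have fp: "full_path (pl k)" "full_path (pl k')" using pl k k' by simp_all
    have xk: "x \<in> k" "y \<in> k'"
      using block_facts(1)[OF fp(1) i] block_facts(1)[OF fp(2) i'] b b' that(4,5) pl[OF k] pl[OF k'] by auto
    show ?thesis
    proof (cases "k = k'")
      case True
      then have "i \<noteq> i'" using that(3) b b' by auto
      then show ?thesis using blocks_separated[OF fp(1) i, of i' x y] i' True b b' that(4,5) by auto
    next
      case False
      then have "(x, y) \<notin> M\<^sup>*" using Keq[OF k k' xk] by blast
      then show ?thesis by auto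
    qed
  qed
  have pieces: "card (reach_avoiding T x) \<le> 3 * s + 1 \<and>
       (card (M `` {x}) \<le> 1 \<longrightarrow> 2 * card (reach_avoiding T x) \<le> 3 * (s + 1))"
    if T: "\<forall>b\<in>\<B>. T \<inter> b \<noteq> {}" and x: "x \<in> V - T" for T x
  proof -
    have k: "K x \<in> K ` V" using x by blast
    have "x \<in> K x" by (simp add: K_def)
    then show ?thesis
      using card_piece[of "pl (K x)" s T x] pl[OF k] T k x s by (auto simp: \<B>_def)
  qed
  show ?thesis
  proof (rule exI[of _ \<B>], intro conjI)
    show "\<Union> \<B> \<subseteq> V" using blk by (intro Union_least) simp
  qed (use fin blk sep pieces in \<open>simp_all\<close>)
qed

end

subsection \<open>Colourings with few monochromatic edges\<close>

context list_graph
begin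

definition listed :: "('a \<Rightarrow> 'c) \<Rightarrow> bool" where
  "listed f \<longleftrightarrow> (\<forall>v\<in>V. f v \<in> L v)"

definition mono_count :: "('a \<Rightarrow> 'c) \<Rightarrow> nat" where
  "mono_count f = card {e \<in> R. f (fst e) = f (snd e)}"

definition optimal :: "('a \<Rightarrow> 'c) \<Rightarrow> bool" where
  "optimal f \<longleftrightarrow> listed f \<and> (\<forall>g. listed g \<longrightarrow> mono_count f \<le> mono_count g)"

definition cdeg :: "('a \<Rightarrow> 'c) \<Rightarrow> 'a \<Rightarrow> 'c \<Rightarrow> nat" where
  "cdeg f v c = card {u. (v, u) \<in> R \<and> f u = c}"

lemma R_symD: "(x, y) \<in> R \<Longrightarrow> (y, x) \<in> R"
  using sym_R by (rule symD)

lemma R_irrefl: "(x, x) \<notin> R"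
  using irrefl_R by (simp add: irrefl_def)

lemma finite_R: "finite R"
  using R_sub finite_V by (meson finite_SigmaI finite_subset)

lemma finite_R_nbrs: "finite (R `` {v})"
  using finite_R by (rule finite_Image)

lemma finite_cnbrs: "finite {u. (v, u) \<in> R \<and> f u = c}"
  by (rule finite_subset[OF _ finite_R_nbrs[of v]]) auto

lemma optimal_exists: "\<exists>f. optimal f"
proof -
  have "listed (\<lambda>v. SOME c. c \<in> L v)"
    using L_nonempty by (auto simp: listed_def some_in_eq)
  then show ?thesis unfolding optimal_def using ex_has_least_nat[of listed _ mono_count] by blast
qed

text \<open>\<open>mono_count\<close> sees every edge in both directions, hence the factor
  2.\<close>

lemma mono_count_split:
  "mono_count f = card {e \<in> R. fst e \<noteq> v \<and> snd e \<noteq> v \<and> f (fst e) = f (snd e)} + 2 * cdeg f v (f v)"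
proof -
  let ?A = "{e \<in> R. fst e \<noteq> v \<and> snd e \<noteq> v \<and> f (fst e) = f (snd e)}"
  let ?N = "{u. (v, u) \<in> R \<and> f u = f v}"
  have eq: "{e \<in> R. f (fst e) = f (snd e)} = ?A \<union> (Pair v ` ?N \<union> (\<lambda>u. (u, v)) ` ?N)"
    by (auto simp: image_iff dest: R_symD)
  have "card (Pair v ` ?N \<union> (\<lambda>u. (u, v)) ` ?N) = card (Pair v ` ?N) + card ((\<lambda>u. (u, v)) ` ?N)"
    by (intro card_Un_disjoint finite_imageI finite_cnbrs) (auto simp: R_irrefl)
  also have "\<dots> = 2 * cdeg f v (f v)"
    by (simp add: card_image inj_on_def cdeg_def)
  finally have 2: "card (Pair v ` ?N \<union> (\<lambda>u. (u, v)) ` ?N) = 2 * cdeg f v (f v)" .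
  show ?thesis unfolding mono_count_def eq 2[symmetric]
    using finite_R by (intro card_Un_disjoint finite_UnI finite_imageI finite_cnbrs) auto
qed

lemma mono_count_update:
  "mono_count (f(v := c)) + 2 * cdeg f v (f v) = mono_count f + 2 * cdeg f v c"
proof -
  have "{e \<in> R. fst e \<noteq> v \<and> snd e \<noteq> v \<and> (f(v := c)) (fst e) = (f(v := c)) (snd e)} =
      {e \<in> R. fst e \<noteq> v \<and> snd e \<noteq> v \<and> f (fst e) = f (snd e)}" by auto
  moreover have "{u. (v, u) \<in> R \<and> (f(v := c)) u = c} = {u. (v, u) \<in> R \<and> f u = c}"
    using R_irrefl by auto
  then have "cdeg (f(v := c)) v ((f(v := c)) v) = cdeg f v c" by (simp add: cdeg_def)
  ultimately show ?thesis
    using mono_count_split[of f v] mono_count_split[of "f(v := c)" v] by simp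
qed

lemma optimal_cdeg_le:
  assumes "optimal f" "v \<in> V" "c \<in> L v"
  shows "cdeg f v (f v) \<le> cdeg f v c"
proof -
  have "listed (f(v := c))" using assms by (auto simp: optimal_def listed_def)
  then have "mono_count f \<le> mono_count (f(v := c))" using assms(1) by (simp add: optimal_def)
  then show ?thesis using mono_count_update[of f v c] by linarith
qed

lemma optimal_update:
  assumes "optimal f" "v \<in> V" "c \<in> L v" "cdeg f v c = cdeg f v (f v)"
  shows "optimal (f(v := c))"
  using assms mono_count_update[of f v c] by (auto simp: optimal_def listed_def)

lemma sum_cdeg_le:
  assumes "finite C"
  shows "(\<Sum>c\<in>C. cdeg f v c) \<le> card (R `` {v})"
proof -
  let ?N = "\<lambda>c. {u. (v, u) \<in> R \<and> f u = c}"
  have fin: "\<forall>c\<in>C. finite (?N c)" using finite_cnbrs[of v f] by blast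
  have dis: "\<forall>c\<in>C. \<forall>d\<in>C. c \<noteq> d \<longrightarrow> ?N c \<inter> ?N d = {}" by auto
  have "(\<Sum>c\<in>C. cdeg f v c) = card (\<Union>c\<in>C. ?N c)"
    unfolding cdeg_def card_UN_disjoint[OF assms fin dis] ..
  also have "\<dots> \<le> card (R `` {v})" by (intro card_mono finite_R_nbrs) auto
  finally show ?thesis .
qed

lemma slack_degree:
  assumes "slack a V R L" "v \<in> V"
  shows "(a - 2) * int (card (R `` {v})) < a * int (card (L v))"
proof -
  have "(\<Sum>w\<in>{v}. int (card (R `` {w} \<inter> {v}))) <
     (\<Sum>w\<in>{v}. a * int (card (L w)) - (a - 2) * int (card (R `` {w})))"
    by (rule assms(1)[unfolded slack_def, rule_format]) (use assms(2) in auto)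
  then show ?thesis by simp
qed

text \<open>Among the colours in the list of \<open>v\<close>, its own is rarest in the
  neighbourhood, so its count is at most the average.\<close>

lemma optimal_mono_degree:
  assumes "optimal f" "v \<in> V"
  shows "card (L v) * cdeg f v (f v) \<le> card (R `` {v})"
proof -
  have "card (L v) * cdeg f v (f v) = (\<Sum>c\<in>L v. cdeg f v (f v))" by simp
  also have "\<dots> \<le> (\<Sum>c\<in>L v. cdeg f v c)" by (intro sum_mono optimal_cdeg_le assms)
  also have "\<dots> \<le> card (R `` {v})" by (rule sum_cdeg_le[OF finite_L[OF assms(2)]])
  finally show ?thesis .
qed

lemma mono_rel_nbrs: "v \<in> V \<Longrightarrow> mono_rel R V f `` {v} = {u. (v, u) \<in> R \<and> f u = f v}"
  using R_sub by (auto simp: mono_rel_def)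

text \<open>For a single vertex, slack with \<open>a = 4\<close> says that the degree is less than
  twice the size of the list, so the average count is below 2 and the monochromatic edges form a
  matching.\<close>

lemma clustered_2:
  assumes "slack 4 V R L"
  shows "\<exists>f. (\<forall>v\<in>V. f v \<in> L v) \<and> clustered R V f 2"
proof -
  obtain f where f: "optimal f" using optimal_exists by blast
  have d1: "cdeg f v (f v) \<le> 1" if v: "v \<in> V" for v
  proof (rule ccontr)
    assume "\<not> ?thesis"
    then have "card (L v) * 2 \<le> card (L v) * cdeg f v (f v)" by (intro mult_left_mono) auto
    moreover have "card (R `` {v}) < 2 * card (L v)" using slack_degree[OF assms v] by simp
    ultimately show False using optimal_mono_degree[OF f v] by linarith
  qed
  have "card ((mono_rel R V f)\<^sup>* `` {v}) \<le> 2" if v: "v \<in> V" for v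
  proof -
    let ?N = "{u. (v, u) \<in> R \<and> f u = f v}"
    have "x \<in> insert v ?N" if "(v, x) \<in> (mono_rel R V f)\<^sup>*" for x
      using that
    proof (induction rule: rtrancl_induct)
      case (step x y)
      show ?case
      proof (cases "x = v")
        case True then show ?thesis using step(2) by (auto simp: mono_rel_def)
      next
        case False
        then have x: "(v, x) \<in> R" "f x = f v" using step.IH by auto
        then have xV: "x \<in> V" using R_sub by blast
        have "v \<in> {u. (x, u) \<in> R \<and> f u = f x}" "y \<in> {u. (x, u) \<in> R \<and> f u = f x}"
          using x R_symD step(2) by (auto simp: mono_rel_def)
        then have "card {v, y} \<le> card {u. (x, u) \<in> R \<and> f u = f x}"
          by (intro card_mono finite_cnbrs) blast
        then have "card {v, y} \<le> 1" using d1[OF xV] by (simp add: cdeg_def)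
        then show ?thesis by (cases "v = y") auto
      qed
    qed simp
    then have "(mono_rel R V f)\<^sup>* `` {v} \<subseteq> insert v ?N" by blast
    then have "card ((mono_rel R V f)\<^sup>* `` {v}) \<le> card (insert v ?N)"
      by (intro card_mono finite.insertI finite_cnbrs)
    also have "\<dots> \<le> 2" using d1[OF v] card_insert_le_m1[of 2 ?N v] by (simp add: cdeg_def)
    finally show ?thesis .
  qed
  then show ?thesis using f by (auto simp: optimal_def listed_def clustered_def)
qed

section \<open>Switching vertices of an optimal colouring\<close>

lemma cdeg_update_le:
  assumes "(w, v) \<in> R \<Longrightarrow> c \<noteq> d"
  shows "cdeg (f(v := c)) w d \<le> cdeg f w d"
  unfolding cdeg_def by (rule card_mono[OF finite_cnbrs]) (use assms in auto)

lemma cdeg_update_ge: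
  assumes "(w, v) \<in> R \<Longrightarrow> f v \<noteq> d"
  shows "cdeg f w d \<le> cdeg (f(v := c)) w d"
  unfolding cdeg_def by (rule card_mono[OF finite_cnbrs]) (use assms in auto)

text \<open>Equal counts for the old and the new colour make the switch neutral for the number of
  monochromatic edges; the common value 2 singles out inner vertices of paths and vertices of
  cycles.\<close>

definition switchable :: "('a \<Rightarrow> 'c) \<Rightarrow> 'a \<Rightarrow> 'c \<Rightarrow> bool" where
  "switchable f v c \<longleftrightarrow> v \<in> V \<and> c \<in> L v \<and> c \<noteq> f v \<and> cdeg f v (f v) = 2 \<and> cdeg f v c = 2"

definition switch :: "('a \<Rightarrow> 'c) \<Rightarrow> 'a set \<Rightarrow> ('a \<Rightarrow> 'c) \<Rightarrow> 'a \<Rightarrow> 'c" where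
  "switch f T \<tau> = (\<lambda>v. if v \<in> T then \<tau> v else f v)"

text \<open>The vertices are switched one at a time. As adjacent ones differ in both old and new
  colours, a switch at \<open>v\<close> neither lowers the count of the old colour at
  \<open>w\<close> nor raises that of the new one; optimality of the intermediate colouring then
  keeps both at 2.\<close>

lemma optimal_switch:
  assumes "finite T" "optimal f" and le2: "\<And>g v. optimal g \<Longrightarrow> v \<in> V \<Longrightarrow> cdeg g v (g v) \<le> 2"
    and "\<And>v. v \<in> T \<Longrightarrow> switchable f v (\<tau> v)"
    and "\<And>v w. v \<in> T \<Longrightarrow> w \<in> T \<Longrightarrow> (v, w) \<in> R \<Longrightarrow> f v \<noteq> f w \<and> \<tau> v \<noteq> \<tau> w"
  shows "optimal (switch f T \<tau>)"
  using assms(1,2,4,5)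
proof (induction T arbitrary: f rule: finite_induct)
  case (insert v T)
  have v: "switchable f v (\<tau> v)" using insert.prems(2) by simp
  define g where "g = f(v := \<tau> v)"
  have og: "optimal g" unfolding g_def
    using v insert.prems(1) by (intro optimal_update) (auto simp: switchable_def)
  have "switchable g w (\<tau> w)" if w: "w \<in> T" for w
  proof -
    have sw: "switchable f w (\<tau> w)" using insert.prems(2) w by simp
    then have wV: "w \<in> V" "\<tau> w \<in> L w" by (auto simp: switchable_def)
    have gw: "g w = f w" using w insert.hyps by (auto simp: g_def)
    have R: "f w \<noteq> f v" "\<tau> w \<noteq> \<tau> v" if "(w, v) \<in> R" using insert.prems(3)[of w v] w that by auto
    have "cdeg f w (f w) \<le> cdeg g w (f w)" unfolding g_def by (rule cdeg_update_ge) (use R in auto)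
    moreover have "cdeg g w (f w) \<le> 2" using le2[OF og wV(1)] gw by simp
    moreover have "cdeg g w (\<tau> w) \<le> cdeg f w (\<tau> w)" unfolding g_def by (rule cdeg_update_le) (use R in auto)
    moreover have "cdeg g w (f w) \<le> cdeg g w (\<tau> w)" using optimal_cdeg_le[OF og wV] gw by simp
    ultimately show ?thesis using sw gw by (simp add: switchable_def)
  qed
  moreover have "g u \<noteq> g w \<and> \<tau> u \<noteq> \<tau> w" if "u \<in> T" "w \<in> T" "(u, w) \<in> R" for u w
    using insert.prems(3)[of u w] that insert.hyps by (auto simp: g_def)
  ultimately have "optimal (switch g T \<tau>)" using insert.IH[OF og] by blast
  moreover have "switch g T \<tau> = switch f (insert v T) \<tau>"
    using insert.hyps by (auto simp: switch_def g_def)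
  ultimately show ?case by simp
qed (simp add: switch_def)

end

locale slack3_graph = list_graph V R L
  for V :: "'a set" and R :: "('a \<times> 'a) set" and L :: "'a \<Rightarrow> 'c set" +
  assumes slack3: "slack 3 V R L" and card_L: "v \<in> V \<Longrightarrow> card (L v) \<le> 8"
begin

text \<open>This is the slack condition on a single vertex; 23 is \<open>3 * 8 - 1\<close>.\<close>

lemma degree_le: "v \<in> V \<Longrightarrow> card (R `` {v}) < 3 * card (L v)" "v \<in> V \<Longrightarrow> card (R `` {v}) \<le> 23"
  using slack_degree[OF slack3, of v] card_L[of v] by auto

lemma mono_degree_le2:
  assumes "optimal f" "v \<in> V"
  shows "cdeg f v (f v) \<le> 2"
proof (rule ccontr)
  assume "\<not> ?thesis"
  then have "card (L v) * 3 \<le> card (L v) * cdeg f v (f v)" by (intro mult_left_mono) auto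
  then show False using optimal_mono_degree[OF assms] degree_le(1)[OF assms(2)] by linarith
qed

text \<open>Every other colour in the list occurs at least twice among the neighbours, and at least
  three times unless \<open>v\<close> can be switched to it. Two further neighbours share the colour
  of \<open>v\<close>.\<close>

lemma card_switchable:
  assumes f: "optimal f" and v: "v \<in> V" "cdeg f v (f v) = 2"
  shows "3 * card (L v) \<le> card {c. switchable f v c} + card (R `` {v}) + 1"
proof -
  let ?C = "L v - {f v}"
  have fv: "f v \<in> L v" using f v(1) by (simp add: optimal_def listed_def)
  have fin: "finite (L v)" using finite_L[OF v(1)] .
  have S: "{c. switchable f v c} = {c \<in> ?C. cdeg f v c = 2}" using v by (auto simp: switchable_def)
  have "3 * card ?C = (\<Sum>c\<in>?C. 3)" by simp
  also have "\<dots> \<le> (\<Sum>c\<in>?C. cdeg f v c + (if cdeg f v c = 2 then 1 else 0))"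
  proof (rule sum_mono)
    fix c assume "c \<in> ?C"
    then have "2 \<le> cdeg f v c" using optimal_cdeg_le[OF f v(1), of c] v(2) by simp
    then show "3 \<le> cdeg f v c + (if cdeg f v c = 2 then 1 else 0)" by simp
  qed
  also have "\<dots> = (\<Sum>c\<in>?C. cdeg f v c) + card {c. switchable f v c}"
    using fin by (simp add: sum.distrib S sum.If_cases Int_def)
  finally have 1: "3 * card ?C \<le> (\<Sum>c\<in>?C. cdeg f v c) + card {c. switchable f v c}" .
  have "(\<Sum>c\<in>L v. cdeg f v c) = cdeg f v (f v) + (\<Sum>c\<in>?C. cdeg f v c)"
    using fin fv by (rule sum.remove)
  then have "2 + (\<Sum>c\<in>?C. cdeg f v c) \<le> card (R `` {v})" using sum_cdeg_le[OF fin, of f v] v(2) by simp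
  moreover have "card (L v) = Suc (card ?C)" using fin fv by (rule card.remove)
  ultimately show ?thesis using 1 by linarith
qed

lemma max_deg2_mono_rel:
  assumes "optimal f"
  shows "max_deg2 V (mono_rel R V f)"
proof
  show "sym (mono_rel R V f)" using R_symD by (auto simp: mono_rel_def sym_def)
  show "irrefl (mono_rel R V f)" using R_irrefl by (auto simp: mono_rel_def irrefl_def)
  show "card (mono_rel R V f `` {v}) \<le> 2" if "v \<in> V" for v
    using mono_degree_le2[OF assms that] by (simp add: mono_rel_nbrs[OF that] cdeg_def)
qed (use finite_V in \<open>auto simp: mono_rel_def\<close>)

lemma card_mono_rel: "v \<in> V \<Longrightarrow> card (mono_rel R V f `` {v}) = cdeg f v (f v)"
  by (simp add: mono_rel_nbrs cdeg_def)

lemma reach_same_colour: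
  assumes "(x, y) \<in> (mono_rel R V f)\<^sup>*"
  shows "f x = f y"
  using assms by (induction rule: rtrancl_induct) (auto simp: mono_rel_def)

text \<open>By slack, the sum of \<open>3 * card (L v)\<close> minus the degree over the block
  exceeds \<open>2 * (card b - 1)\<close>. Giving up 1 per vertex, as \<open>card_switchable\<close>
  requires, leaves more than \<open>card b - 2\<close> switches.\<close>

lemma card_block_switches:
  assumes f: "optimal f" and b: "b \<subseteq> V" "b \<noteq> {}" "\<And>v. v \<in> b \<Longrightarrow> cdeg f v (f v) = 2"
    and e: "2 * (card b - 1) \<le> (\<Sum>v\<in>b. card (mono_rel R V f `` {v} \<inter> b))"
  shows "card b - 1 \<le> card (SIGMA v:b. {c. switchable f v c})"
proof -
  have fb: "finite b" using b(1) finite_V finite_subset by blast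
  have fS: "finite {c. switchable f v c}" if "v \<in> b" for v
    using finite_L[of v] b(1) that by (auto simp: switchable_def intro: finite_subset[of _ "L v"])
  have "card (mono_rel R V f `` {v} \<inter> b) \<le> card (R `` {v} \<inter> b)" for v
    using finite_R_nbrs[of v] by (intro card_mono) (auto simp: mono_rel_def)
  then have "(\<Sum>v\<in>b. card (mono_rel R V f `` {v} \<inter> b)) \<le> (\<Sum>v\<in>b. card (R `` {v} \<inter> b))"
    by (intro sum_mono)
  then have "2 * (card b - 1) \<le> (\<Sum>v\<in>b. card (R `` {v} \<inter> b))" using e by linarith
  then have 0: "2 * int (card b - 1) \<le> (\<Sum>v\<in>b. int (card (R `` {v} \<inter> b)))"
    by (metis of_nat_le_iff of_nat_mult of_nat_numeral of_nat_sum)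
  have "(\<Sum>v\<in>b. int (card (R `` {v} \<inter> b))) <
      (\<Sum>v\<in>b. 3 * int (card (L v)) - (3 - 2) * int (card (R `` {v})))"
    by (rule slack3[unfolded slack_def, rule_format]) (use b in auto)
  also have "\<dots> \<le> (\<Sum>v\<in>b. int (card {c. switchable f v c}) + 1)"
  proof (rule sum_mono)
    fix v assume v: "v \<in> b"
    show "3 * int (card (L v)) - (3 - 2) * int (card (R `` {v})) \<le> int (card {c. switchable f v c}) + 1"
      using card_switchable[OF f _ b(3)[OF v]] b(1) v by force
  qed
  also have "\<dots> = int (card (SIGMA v:b. {c. switchable f v c})) + int (card b)"
    using fb fS by (simp add: sum.distrib)
  finally have "2 * int (card b - 1) < int (card (SIGMA v:b. {c. switchable f v c})) + int (card b)"
    using 0 by linarith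
  then show ?thesis using b(2) fb by (simp add: card_gt_0_iff)
qed

text \<open>Switching \<open>v\<close> to \<open>c\<close> joins it to end vertices of components of colour \<open>c\<close>. A conflict is a pair of
  switches that creates a monochromatic edge or uses both ends of one component, so that longer
  chains of components could arise.\<close>

definition mates :: "('a \<Rightarrow> 'c) \<Rightarrow> 'a \<Rightarrow> 'a \<Rightarrow> bool" where
  "mates f x y \<longleftrightarrow> x \<in> V \<and> y \<in> V \<and> (x, y) \<in> (mono_rel R V f)\<^sup>* \<and>
     cdeg f x (f x) \<le> 1 \<and> cdeg f y (f y) \<le> 1 \<and> (x = y \<longrightarrow> cdeg f x (f x) = 0)"

definition conflict :: "('a \<Rightarrow> 'c) \<Rightarrow> 'a \<times> 'c \<Rightarrow> 'a \<times> 'c \<Rightarrow> bool" where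
  "conflict f = (\<lambda>(v, c) (w, d). c = d \<and> v \<noteq> w \<and>
     ((v, w) \<in> R \<and> f v \<noteq> f w \<or>
      (\<exists>x y. (v, x) \<in> R \<and> f x = c \<and> (w, y) \<in> R \<and> f y = c \<and> mates f x y)))"

lemma mates_sym: "mates f x y \<Longrightarrow> mates f y x"
proof -
  have "sym (mono_rel R V f)" using R_symD by (auto simp: mono_rel_def sym_def)
  then have "sym ((mono_rel R V f)\<^sup>*)" by (rule sym_rtrancl)
  then show "mates f x y \<Longrightarrow> mates f y x" by (auto simp: mates_def dest: symD)
qed

lemma symp_conflict: "symp (conflict f)"
proof (rule sympI)
  fix a b assume "conflict f a b"
  then show "conflict f b a"
    using mates_sym R_symD by (cases a; cases b) (simp add: conflict_def, metis)
qed

text \<open>An isolated vertex has only itself as a mate, and an end of a longer path only the other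
  end.\<close>

lemma mates_unique:
  assumes f: "optimal f"
  shows "\<exists>y0. {y. mates f x y} \<subseteq> {y0}"
proof (cases "x \<in> V \<and> cdeg f x (f x) \<le> 1")
  case False then show ?thesis by (auto simp: mates_def)
next
  case x: True
  interpret max_deg2 V "mono_rel R V f" by (rule max_deg2_mono_rel[OF f])
  show ?thesis
  proof (cases "cdeg f x (f x) = 0")
    case True
    then have n: "mono_rel R V f `` {x} = {}"
      using x finite_nbrs card_mono_rel[of x f] by simp
    have "y = x" if "(x, y) \<in> (mono_rel R V f)\<^sup>*" for y
      using that n by (cases rule: converse_rtranclE) auto
    then show ?thesis by (auto simp: mates_def)
  next
    case False
    obtain y0 where y0: "{y. (x, y) \<in> (mono_rel R V f)\<^sup>* \<and> y \<noteq> x \<and> card (mono_rel R V f `` {y}) \<le> 1} \<subseteq> {y0}"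
      using other_end_unique[of x] x card_mono_rel[of x f] by auto
    have "{y. mates f x y} \<subseteq> {y. (x, y) \<in> (mono_rel R V f)\<^sup>* \<and> y \<noteq> x \<and> card (mono_rel R V f `` {y}) \<le> 1}"
      using False by (auto simp: mates_def card_mono_rel)
    then show ?thesis using y0 by blast
  qed
qed

text \<open>Conflicting switches share the colour \<open>c\<close>, so it suffices to count
  vertices. \<open>W1\<close> has at most \<open>23 - 2 - 2\<close> elements: neighbours of
  \<open>v\<close> without the two of colour \<open>c\<close> and the two of colour
  \<open>f v\<close>. \<open>W2\<close> has at most \<open>2 * 23\<close>: each of the two
  neighbours of colour \<open>c\<close> has at most one mate, with at most 23 neighbours.\<close>

lemma card_conflict_le:
  assumes f: "optimal f" and v: "switchable f v c" and U: "\<And>w d. (w, d) \<in> U \<Longrightarrow> switchable f w d"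
  shows "card {z \<in> U. conflict f (v, c) z} \<le> 65"
proof -
  have vV: "v \<in> V" and c2: "c \<noteq> f v" "cdeg f v (f v) = 2" "cdeg f v c = 2"
    using v by (auto simp: switchable_def)
  let ?N = "\<lambda>d. {u. (v, u) \<in> R \<and> f u = d}"
  obtain m where m: "\<And>x y. mates f x y \<Longrightarrow> y = m x"
    using mates_unique[OF f] by (metis mem_Collect_eq singletonD subsetD)
  define W1 where "W1 = R `` {v} - (?N c \<union> ?N (f v))"
  \<comment> \<open>\<open>m x\<close> is arbitrary if \<open>x\<close> has no mate; requiring
    \<open>m x \<in> V\<close> makes the degree bound applicable.\<close>
  define X where "X = {x \<in> ?N c. m x \<in> V}"
  define W2 where "W2 = (\<Union>x\<in>X. R `` {m x})"
  have fX: "finite X" unfolding X_def by (rule finite_subset[OF _ finite_cnbrs[of v f c]]) auto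
  have fW: "finite W1" "finite W2" using finite_R_nbrs fX by (auto simp: W1_def W2_def)
  have sub: "{z \<in> U. conflict f (v, c) z} \<subseteq> (\<lambda>w. (w, c)) ` (W1 \<union> W2)"
  proof
    fix z assume z: "z \<in> {z \<in> U. conflict f (v, c) z}"
    then obtain w where w: "z = (w, c)" "conflict f (v, c) (w, c)"
      by (cases z) (auto simp: conflict_def)
    have cw: "f w \<noteq> c" using U z w(1) by (auto simp: switchable_def)
    show "z \<in> (\<lambda>w. (w, c)) ` (W1 \<union> W2)"
    proof (cases "\<exists>x y. (v, x) \<in> R \<and> f x = c \<and> (w, y) \<in> R \<and> f y = c \<and> mates f x y")
      case True
      then obtain x y where xy: "(v, x) \<in> R" "f x = c" "(w, y) \<in> R" "mates f x y" by blast
      then have "y = m x" "y \<in> V" using m by (auto simp: mates_def)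
      then have "w \<in> W2" using xy R_symD[OF xy(3)] by (auto simp: W2_def X_def)
      then show ?thesis using w by simp
    next
      case False
      then have w1: "(v, w) \<in> R" "f v \<noteq> f w" using w(2) by (auto simp: conflict_def)
      then have "w \<in> W1" using cw by (auto simp: W1_def)
      then show ?thesis using w by simp
    qed
  qed
  have "card W1 = card (R `` {v}) - card (?N c \<union> ?N (f v))"
    unfolding W1_def by (rule card_Diff_subset) (auto simp: finite_cnbrs)
  also have "card (?N c \<union> ?N (f v)) = card (?N c) + card (?N (f v))"
    by (rule card_Un_disjoint[OF finite_cnbrs finite_cnbrs]) (use c2(1) in auto)
  finally have c1: "card W1 \<le> 19" using degree_le(2)[OF vV] c2 by (simp add: cdeg_def)
  have "card W2 \<le> (\<Sum>x\<in>X. card (R `` {m x}))" unfolding W2_def by (rule card_UN_le[OF fX])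
  also have "\<dots> \<le> (\<Sum>x\<in>X. 23)" by (rule sum_mono) (auto simp: X_def intro: degree_le(2))
  also have "\<dots> = card X * 23" by simp
  also have "card X \<le> card (?N c)" unfolding X_def by (rule card_mono[OF finite_cnbrs]) auto
  finally have "card W2 \<le> 46" using c2(3) by (simp add: cdeg_def)
  then have "card (W1 \<union> W2) \<le> 65" using c1 card_Un_le[of W1 W2] by linarith
  moreover have "card {z \<in> U. conflict f (v, c) z} \<le> card (W1 \<union> W2)"
    using card_mono[OF _ sub] card_image_le[of "W1 \<union> W2" "\<lambda>w. (w, c)"] fW by (meson finite_UnI finite_imageI le_trans)
  ultimately show ?thesis by linarith
qed

text \<open>All of \<open>T\<close> become monochromatic neighbours of \<open>x\<close>, which also
  keeps those it had, and the degree bound 2 still holds after the switch. Hence one switched vertex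
  can attach only to an end of a component, and two can share only an isolated vertex.\<close>

lemma card_attached_le:
  assumes f: "optimal f" and g: "optimal (switch f T \<tau>)" and T: "finite T"
    and x: "x \<in> V" and t: "\<And>v. v \<in> T \<Longrightarrow> (v, x) \<in> R \<and> \<tau> v = f x \<and> f v \<noteq> f x"
  shows "card T + cdeg f x (f x) \<le> 2"
proof -
  let ?g = "switch f T \<tau>"
  have "x \<notin> T" using t R_irrefl by blast
  then have gx: "?g x = f x" by (simp add: switch_def)
  have "card (T \<union> {u. (x, u) \<in> R \<and> f u = f x}) \<le> card {u. (x, u) \<in> R \<and> ?g u = f x}"
    by (rule card_mono[OF finite_cnbrs]) (use t R_symD in \<open>auto simp: switch_def\<close>)
  also have "\<dots> \<le> 2" using mono_degree_le2[OF g x] by (simp add: gx cdeg_def)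
  also have "card (T \<union> {u. (x, u) \<in> R \<and> f u = f x}) = card T + cdeg f x (f x)"
    unfolding cdeg_def by (rule card_Un_disjoint[OF T finite_cnbrs]) (use t in auto)
  finally show ?thesis .
qed

text \<open>Blocks of 131 vertices contain at least \<open>130 = 2 * 65\<close> switches, as Haxell's theorem requires. They
  leave pieces of at most \<open>3 * 131 + 1\<close> vertices, and of at most 198 vertices at the ends of a path.\<close>

lemma clustered_405: "\<exists>f. (\<forall>v\<in>V. f v \<in> L v) \<and> clustered R V f 405"
proof -
  obtain f where f: "optimal f" using optimal_exists by blast
  let ?M = "mono_rel R V f"
  interpret M: max_deg2 V ?M by (rule max_deg2_mono_rel[OF f])
  have s: "0 < (131 :: nat)" by simp
  obtain \<B> where fB: "finite \<B>" and BV: "\<Union> \<B> \<subseteq> V"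
    and B1: "\<forall>b\<in>\<B>. card b = 131 \<and> (\<forall>x\<in>b. card (?M `` {x}) = 2) \<and>
       2 * (131 - 1) \<le> (\<Sum>x\<in>b. card (?M `` {x} \<inter> b))"
    and B2: "\<forall>b\<in>\<B>. \<forall>b'\<in>\<B>. b \<noteq> b' \<longrightarrow> (\<forall>x\<in>b. \<forall>y\<in>b'. x \<noteq> y \<and> (x, y) \<notin> ?M)"
    and B3: "\<forall>T. (\<forall>b\<in>\<B>. T \<inter> b \<noteq> {}) \<longrightarrow> (\<forall>x\<in>V - T. card (M.reach_avoiding T x) \<le> 3 * 131 + 1 \<and>
       (card (?M `` {x}) \<le> 1 \<longrightarrow> 2 * card (M.reach_avoiding T x) \<le> 3 * (131 + 1)))"
  proof -
    show ?thesis using M.block_system_exists[OF s] by (elim exE conjE) (rule that)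
  qed
  note Bb = B1[THEN bspec]
  note Bpc = B3[THEN spec, THEN mp]
  have Bsep: "x \<noteq> y \<and> (x, y) \<notin> ?M" if "b \<in> \<B>" "b' \<in> \<B>" "b \<noteq> b'" "x \<in> b" "y \<in> b'" for b b' x y
    using B2 that by simp
  define P where "P b = (SIGMA v:b. {c. switchable f v c})" for b
  have "\<exists>t. indep_transversal P (conflict f) \<B> t"
  proof (rule indep_transversal_exists[OF fB symp_conflict, of 65])
    show "P b \<inter> P b' = {}" if "b \<in> \<B>" "b' \<in> \<B>" "b \<noteq> b'" for b b'
      using Bsep[OF that] by (auto simp: P_def)
    show "2 * 65 \<le> card (P b)" if b: "b \<in> \<B>" for b
    proof -
      have bV: "b \<subseteq> V" using BV b by blast
      have "card b - 1 \<le> card (P b)" unfolding P_def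
      proof (rule card_block_switches[OF f bV])
        show "b \<noteq> {}" using Bb[OF b] by auto
        show "cdeg f v (f v) = 2" if "v \<in> b" for v
          using Bb[OF b] that bV card_mono_rel[of v f] by auto
      qed (use Bb[OF b] in auto)
      then show ?thesis using Bb[OF b] by simp
    qed
    show "card {u \<in> \<Union> (P ` \<B>). conflict f z u} \<le> 65" if "z \<in> \<Union> (P ` \<B>)" for z
    proof -
      obtain v c where z: "z = (v, c)" by (cases z)
      show ?thesis unfolding z
        by (rule card_conflict_le[OF f]) (use that z in \<open>auto simp: P_def\<close>)
    qed
  qed simp
  then obtain t where t: "\<And>b. b \<in> \<B> \<Longrightarrow> t b \<in> P b"
    and tind: "\<And>b b'. b \<in> \<B> \<Longrightarrow> b' \<in> \<B> \<Longrightarrow> b \<noteq> b' \<Longrightarrow> \<not> conflict f (t b) (t b')"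
    unfolding indep_transversal_def by metis
  define T where "T = fst ` t ` \<B>"
  have "\<forall>v\<in>T. \<exists>b c. b \<in> \<B> \<and> t b = (v, c)"
  proof
    fix v assume "v \<in> T"
    then obtain b where "b \<in> \<B>" "v = fst (t b)" by (auto simp: T_def)
    then show "\<exists>b c. b \<in> \<B> \<and> t b = (v, c)" by (metis prod.collapse)
  qed
  then obtain \<beta> \<tau> where \<beta>: "\<And>v. v \<in> T \<Longrightarrow> \<beta> v \<in> \<B>" "\<And>v. v \<in> T \<Longrightarrow> t (\<beta> v) = (v, \<tau> v)" by metis
  have fT: "finite T" using fB by (simp add: T_def)
  have Tsw: "v \<in> \<beta> v" "switchable f v (\<tau> v)" if "v \<in> T" for v
    using t[OF \<beta>(1)[OF that]] \<beta>(2)[OF that] by (auto simp: P_def)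
  have Tsep: "\<not> conflict f (v, \<tau> v) (w, \<tau> w)" "(v, w) \<notin> ?M" if "v \<in> T" "w \<in> T" "v \<noteq> w" for v w
  proof -
    have "\<beta> v \<noteq> \<beta> w" using \<beta>(2)[OF that(1)] \<beta>(2)[OF that(2)] that(3) by auto
    then show "\<not> conflict f (v, \<tau> v) (w, \<tau> w)" "(v, w) \<notin> ?M"
      using tind[of "\<beta> v" "\<beta> w"] Bsep[of "\<beta> v" "\<beta> w" v w] \<beta> that Tsw(1) by auto
  qed
  have TV: "T \<subseteq> V" using Tsw(2) by (auto simp: switchable_def)
  have Tcol: "f v \<noteq> f w \<and> \<tau> v \<noteq> \<tau> w" if vw: "v \<in> T" "w \<in> T" "(v, w) \<in> R" for v w
  proof -
    have ne: "v \<noteq> w" using vw(3) R_irrefl by blast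
    have "f v \<noteq> f w" using Tsep(2)[OF vw(1,2) ne] vw TV by (auto simp: mono_rel_def)
    then show ?thesis using Tsep(1)[OF vw(1,2) ne] vw(3) ne by (auto simp: conflict_def)
  qed
  \<comment> \<open>All subsets are covered because \<open>card_attached_le\<close> is applied to
    one or two switched vertices at a time.\<close>
  have opt: "optimal (switch f T' \<tau>)" if "T' \<subseteq> T" for T'
    using that Tsw(2) Tcol mono_degree_le2 finite_subset[OF that fT] by (intro optimal_switch[OF _ f]) blast+
  define g where "g = switch f T \<tau>"
  have og: "optimal g" unfolding g_def by (rule opt) simp
  let ?M' = "mono_rel R V g"
  define N where "N x = M.reach_avoiding T x" for x
  have hit: "\<forall>b\<in>\<B>. T \<inter> b \<noteq> {}"
  proof
    fix b assume b: "b \<in> \<B>"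
    then have "fst (t b) \<in> T \<inter> b" using t[OF b] by (auto simp: T_def P_def)
    then show "T \<inter> b \<noteq> {}" by blast
  qed
  have gT: "g v = \<tau> v" if "v \<in> T" for v using that by (simp add: g_def switch_def)
  have gnT: "g v = f v" if "v \<notin> T" for v using that by (simp add: g_def switch_def)
  have \<tau>f: "\<tau> v \<noteq> f v" if "v \<in> T" for v using Tsw(2)[OF that] by (simp add: switchable_def)
  have end1: "x \<in> V \<and> cdeg f x (f x) \<le> 1 \<and> x \<notin> T" if vx: "v \<in> T" "(v, x) \<in> R" "f x = \<tau> v" for v x
  proof -
    have xV: "x \<in> V" using vx(2) R_sub by blast
    have "card {v} + cdeg f x (f x) \<le> 2"
      by (rule card_attached_le[OF f opt _ xV]) (use vx \<tau>f in \<open>auto dest: sym\<close>)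
    then have "cdeg f x (f x) \<le> 1" by simp
    moreover have "x \<notin> T" using calculation Tsw(2)[of x] by (auto simp: switchable_def)
    ultimately show ?thesis using xV by blast
  qed
  have end2: "cdeg f x (f x) = 0"
    if vx: "v \<in> T" "w \<in> T" "v \<noteq> w" "(v, x) \<in> R" "(w, x) \<in> R" "f x = \<tau> v" "f x = \<tau> w" for v w x
  proof -
    have xV: "x \<in> V" using vx(4) R_sub by blast
    have "card {v, w} + cdeg f x (f x) \<le> 2"
      by (rule card_attached_le[OF f opt _ xV]) (use vx \<tau>f in \<open>auto dest: sym\<close>)
    then show ?thesis using vx(3) by simp
  qed
  have symM': "sym (?M'\<^sup>*)" using max_deg2.sym_M[OF max_deg2_mono_rel[OF og]] by (rule sym_rtrancl)
  have NM: "(x, y) \<in> ?M\<^sup>*" if "y \<in> N x" for x y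
    using that rtrancl_mono[of "?M \<inter> (- T) \<times> (- T)" ?M] by (auto simp: N_def M.reach_avoiding_def)
  have NT: "y \<notin> T" if "y \<in> N x" "x \<notin> T" for x y
  proof -
    have "(x, y) \<in> (?M \<inter> (- T) \<times> (- T))\<^sup>*" using that(1) by (simp add: N_def M.reach_avoiding_def)
    then show ?thesis by (cases rule: rtranclE) (use that(2) in auto)
  qed
  have Nstep: "z \<in> N x" if "y \<in> N x" "x \<notin> T" "(y, z) \<in> ?M'" "z \<notin> T" for x y z
  proof -
    have "(y, z) \<in> ?M \<inter> (- T) \<times> (- T)"
      using that(3,4) NT[OF that(1,2)] gnT by (auto simp: mono_rel_def)
    moreover have "(x, y) \<in> (?M \<inter> (- T) \<times> (- T))\<^sup>*" using that(1) by (simp add: N_def M.reach_avoiding_def)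
    ultimately have "(x, z) \<in> (?M \<inter> (- T) \<times> (- T))\<^sup>*" by (rule rtrancl.rtrancl_into_rtrancl[rotated])
    then show ?thesis by (simp add: N_def M.reach_avoiding_def)
  qed
  have fN: "finite (N x)" if "x \<in> V" for x
  proof -
    have "y \<in> V" if "(x, y) \<in> ?M\<^sup>*" for y
      using that \<open>x \<in> V\<close> by (induction rule: rtrancl_induct) (auto simp: mono_rel_def)
    then show ?thesis using NM finite_V by (meson finite_subset subsetI)
  qed
  have compT: "card (?M'\<^sup>* `` {v}) \<le> 405" if v: "v \<in> T" for v
  proof -
    let ?X = "{u. (v, u) \<in> R \<and> f u = \<tau> v}"
    have cX: "card ?X = 2" using Tsw(2)[OF v] by (simp add: switchable_def cdeg_def)
    have X: "x \<in> V" "cdeg f x (f x) \<le> 1" "x \<notin> T" if "x \<in> ?X" for x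
      using end1[OF v] that by auto
    have "y \<in> insert v (\<Union>x\<in>?X. N x)" if "(v, y) \<in> ?M'\<^sup>*" for y
      using that
    proof (induction rule: rtrancl_induct)
      case (step y z)
      have yz: "(y, z) \<in> R" "g y = g z" using step(2) by (auto simp: mono_rel_def)
      show ?case
      proof (cases "y = v")
        case True
        have "z \<notin> T" using Tcol[OF v, of z] yz True gT v by auto
        then have "z \<in> ?X" using yz True gT[OF v] gnT by auto
        moreover have "z \<in> N z" by (simp add: N_def M.reach_avoiding_def)
        ultimately show ?thesis by blast
      next
        case False
        then obtain x where x: "x \<in> ?X" "y \<in> N x" using step.IH by blast
        show ?thesis
        proof (cases "z \<in> T")
          case False
          then show ?thesis using Nstep[OF x(2) X(3)[OF x(1)] step(2)] x(1) by blast
        next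
          case True
          have yT: "y \<notin> T" using NT[OF x(2) X(3)[OF x(1)]] .
          have fxy: "f x = f y" by (rule reach_same_colour[OF NM[OF x(2)]])
          have zy: "(z, y) \<in> R" "f y = \<tau> z" using yz gT[OF True] gnT[OF yT] R_symD by auto
          have y1: "y \<in> V" "cdeg f y (f y) \<le> 1" using end1[OF True zy] by auto
          \<comment> \<open>A second switched vertex \<open>z\<close> at the piece of
            \<open>x\<close> would attach at an end \<open>y\<close> of the same old component, or
            at \<open>x = y\<close>, which is then isolated by \<open>end2\<close>. Either way
            \<open>x\<close> and \<open>y\<close> are mates, and the two switches conflict.\<close>
          have "z = v"
          proof (rule ccontr)
            assume zv: "z \<noteq> v"
            have "mates f x y"
              using X[OF x(1)] y1 NM[OF x(2)] end2[OF v True _ _ _ _, of x] zv x(1) zy fxy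
              by (auto simp: mates_def)
            then have "conflict f (v, \<tau> v) (z, \<tau> z)"
              using x(1) zy fxy zv by (auto simp: conflict_def)
            then show False using Tsep(1)[OF v True] zv by blast
          qed
          then show ?thesis by blast
        qed
      qed
    qed simp
    then have "?M'\<^sup>* `` {v} \<subseteq> insert v (\<Union>x\<in>?X. N x)" by blast
    moreover have "finite (insert v (\<Union>x\<in>?X. N x))"
      by (intro finite.insertI finite_UN_I finite_cnbrs fN X(1))
    ultimately have "card (?M'\<^sup>* `` {v}) \<le> card (insert v (\<Union>x\<in>?X. N x))" by (intro card_mono)
    \<comment> \<open>The component consists of \<open>v\<close> and the end pieces at its two
      neighbours of the new colour: \<open>1 + 2 * 198 = 397\<close> vertices at most.\<close>
    also have "\<dots> \<le> Suc (card (\<Union>x\<in>?X. N x))" by (rule card_insert_le_m1) simp_all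
    also have "card (\<Union>x\<in>?X. N x) \<le> (\<Sum>x\<in>?X. card (N x))" by (rule card_UN_le[OF finite_cnbrs])
    also have "\<dots> \<le> (\<Sum>x\<in>?X. 198)"
    proof (rule sum_mono)
      fix x assume x: "x \<in> ?X"
      have "2 * card (N x) \<le> 3 * (131 + 1)"
        using Bpc[OF hit, THEN bspec, of x] X[OF x] card_mono_rel[of x f] by (auto simp: N_def)
      then show "card (N x) \<le> 198" by simp
    qed
    also have "\<dots> = 396" using cX by simp
    finally show ?thesis by simp
  qed
  have "card (?M'\<^sup>* `` {x}) \<le> 405" if x: "x \<in> V" for x
  proof (cases "\<exists>v\<in>T. (x, v) \<in> ?M'\<^sup>*")
    case True
    then obtain v where v: "v \<in> T" "(x, v) \<in> ?M'\<^sup>*" by blast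
    have "?M'\<^sup>* `` {x} \<subseteq> ?M'\<^sup>* `` {v}" using symD[OF symM' v(2)] by (auto intro: rtrancl_trans)
    moreover have "?M'\<^sup>* `` {v} \<subseteq> ?M'\<^sup>* `` {x}" using v(2) by (auto intro: rtrancl_trans)
    ultimately have "?M'\<^sup>* `` {x} = ?M'\<^sup>* `` {v}" by (rule subset_antisym)
    then show ?thesis using compT[OF v(1)] by simp
  next
    case False
    then have xT: "x \<notin> T" by blast
    have "y \<in> N x" if "(x, y) \<in> ?M'\<^sup>*" for y
      using that
    proof (induction rule: rtrancl_induct)
      case base then show ?case by (simp add: N_def M.reach_avoiding_def)
    next
      case (step y z)
      have "z \<notin> T" using False rtrancl.rtrancl_into_rtrancl[OF step(1,2)] by blast
      then show ?case using Nstep[OF step.IH xT step(2)] by blast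
    qed
    \<comment> \<open>Without a switched vertex the component lies in one old piece, of at most
      \<open>3 * 131 + 1 = 394\<close> vertices.\<close>
    then have "card (?M'\<^sup>* `` {x}) \<le> card (N x)" by (intro card_mono fN[OF x]) blast
    also have "\<dots> \<le> 405" using Bpc[OF hit, THEN bspec, of x] x xT by (simp add: N_def)
    finally show ?thesis .
  qed
  then show ?thesis using og by (auto simp: optimal_def listed_def clustered_def)
qed

end

subsection \<open>Earth-moon graphs\<close>

lemma pair_graphD:
  assumes "pair_graph G"
  shows "finite (pverts G)" "parcs G \<subseteq> pverts G \<times> pverts G" "sym (parcs G)" "irrefl (parcs G)"
proof -
  interpret pair_graph G by (rule assms)
  show "finite (pverts G)" by (rule pair_finite_verts)
  show "parcs G \<subseteq> pverts G \<times> pverts G" using in_arcsD1 in_arcsD2 by auto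
  show "sym (parcs G)" using arcs_symmetric by (auto simp: sym_def)
  show "irrefl (parcs G)" using pair_no_loops by (force simp: irrefl_def)
qed

text \<open>Restricting the drawing to \<open>S\<close> gives at most \<open>3 * card S - 3\<close>
  edges, and each of them accounts for at most two arcs.\<close>

lemma planar_graph_arc_bound:
  assumes "planar_graph G" "S \<subseteq> pverts G" "S \<noteq> {}"
  shows "card (parcs G \<inter> S \<times> S) + 6 \<le> 6 * card S"
proof -
  obtain p D where pD: "plane_drawing G p D" and G: "pair_graph G"
    using assms(1) by (auto simp: planar_graph_def)
  note G' = pair_graphD[OF G]
  define E where "E = {{u, v} | u v. (u, v) \<in> parcs G \<inter> S \<times> S}"
  have EE: "\<exists>u v. e = {u, v} \<and> (u, v) \<in> parcs G \<and> u \<in> S \<and> v \<in> S" if "e \<in> E" for e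
    using that by (auto simp: E_def)
  have inj: "inj_on p (pverts G)" using pD by (simp add: plane_drawing_def)
  have arcs: "\<exists>g. arc g \<and> pathstart g = p u \<and> pathfinish g = p v \<and> path_image g = D {u, v}"
    and verts: "D {u, v} \<inter> p ` pverts G \<subseteq> {p u, p v}" if "(u, v) \<in> parcs G" for u v
    using bspec[OF conjunct1[OF conjunct2[OF pD[unfolded plane_drawing_def]]] that]
      bspec[OF conjunct1[OF conjunct2[OF conjunct2[OF pD[unfolded plane_drawing_def]]]] that] by simp_all
  have cross: "D {u, v} \<inter> D {x, y} \<subseteq> p ` ({u, v} \<inter> {x, y})"
    if "(u, v) \<in> parcs G" "(x, y) \<in> parcs G" "{u, v} \<noteq> {x, y}" for u v x y
  proof -
    have "\<forall>(x, y) \<in> parcs G. {u, v} \<noteq> {x, y} \<longrightarrow> D {u, v} \<inter> D {x, y} \<subseteq> p ` ({u, v} \<inter> {x, y})"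
      using bspec[OF conjunct2[OF conjunct2[OF conjunct2[OF pD[unfolded plane_drawing_def]]]] that(1)] by simp
    from bspec[OF this that(2)] show ?thesis using that(3) by simp
  qed
  have "drawn S E p D" unfolding drawn_def
  proof (intro conjI ballI impI)
    show "finite S" using G'(1) assms(2) finite_subset by blast
    show "inj_on p S" using inj assms(2) by (rule inj_on_subset)
  next
    fix e assume "e \<in> E"
    then obtain u v where uv: "e = {u, v}" "(u, v) \<in> parcs G" "u \<in> S" "v \<in> S" using EE by blast
    have "u \<noteq> v" using uv(2) G'(4) by (auto simp: irrefl_def)
    moreover obtain g where "arc g" "pathstart g = p u" "pathfinish g = p v" "path_image g = D {u, v}"
      using arcs[OF uv(2)] by blast
    ultimately show "\<exists>u v g. e = {u, v} \<and> u \<noteq> v \<and> u \<in> S \<and> v \<in> S \<and>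
        arc g \<and> pathstart g = p u \<and> pathfinish g = p v \<and> path_image g = D e"
      using uv by (intro exI[of _ u] exI[of _ v] exI[of _ g]) simp
    show "D e \<inter> p ` S \<subseteq> p ` e" using verts[OF uv(2)] uv(1) assms(2) by auto
  next
    fix e e' assume e: "e \<in> E" "e' \<in> E" "e \<noteq> e'"
    obtain u v where uv: "e = {u, v}" "(u, v) \<in> parcs G" using EE[OF e(1)] by blast
    obtain x y where xy: "e' = {x, y}" "(x, y) \<in> parcs G" using EE[OF e(2)] by blast
    show "D e \<inter> D e' \<subseteq> p ` (e \<inter> e')"
      using cross[OF uv(2) xy(2)] e(3) unfolding uv(1) xy(1) by blast
  qed
  then have bound: "card E + 3 \<le> 3 * card S" and fE: "finite E"
    using drawn_edge_bound[OF _ assms(3)] drawn_finite(2) by blast+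
  have "parcs G \<inter> S \<times> S \<subseteq> (\<Union>e\<in>E. {(u, v). {u, v} = e})" by (auto simp: E_def)
  moreover have two: "finite {(u, v). {u, v} = e} \<and> card {(u, v). {u, v} = e} \<le> 2" if e0: "e \<in> E" for e
  proof -
    obtain a b where e: "e = {a, b}" using EE[OF e0] by blast
    have sub: "{(u, v). {u, v} = e} \<subseteq> {(a, b), (b, a)}" by (auto simp: e doubleton_eq_iff)
    have "card {(a, b), (b, a)} \<le> Suc (card {(b, a)})" by (rule card_insert_le_m1) simp_all
    moreover have "card {(u, v). {u, v} = e} \<le> card {(a, b), (b, a)}" by (rule card_mono[OF _ sub]) simp
    moreover have "finite {(u, v). {u, v} = e}" by (rule finite_subset[OF sub]) simp
    ultimately show ?thesis by simp
  qed
  ultimately have "card (parcs G \<inter> S \<times> S) \<le> card (\<Union>e\<in>E. {(u, v). {u, v} = e})"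
    using fE by (intro card_mono) auto
  also have "\<dots> \<le> (\<Sum>e\<in>E. card {(u, v). {u, v} = e})" by (rule card_UN_le[OF fE])
  also have "\<dots> \<le> (\<Sum>e\<in>E. 2)" using two by (intro sum_mono) blast
  finally show ?thesis using bound by simp
qed

lemma earth_moon_degree_sum:
  assumes "earth_moon_graph G" "S \<subseteq> pverts G" "S \<noteq> {}"
  shows "(\<Sum>v\<in>S. card (parcs G `` {v} \<inter> S)) < 12 * card S"
proof -
  obtain G1 G2 where G12: "planar_graph G1" "planar_graph G2" "pverts G1 = pverts G" "pverts G2 = pverts G"
    "parcs G = parcs G1 \<union> parcs G2" and G: "pair_graph G"
    using assms(1) by (auto simp: earth_moon_graph_def)
  have fS: "finite S" using pair_graphD(1)[OF G] assms(2) finite_subset by blast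
  have "(\<Sum>v\<in>S. card (parcs G `` {v} \<inter> S)) = card (SIGMA v:S. parcs G `` {v} \<inter> S)"
    using fS by simp
  also have "(SIGMA v:S. parcs G `` {v} \<inter> S) = (parcs G1 \<inter> S \<times> S) \<union> (parcs G2 \<inter> S \<times> S)"
    using G12(5) by auto
  also have "card \<dots> \<le> card (parcs G1 \<inter> S \<times> S) + card (parcs G2 \<inter> S \<times> S)" by (rule card_Un_le)
  finally show ?thesis
    using planar_graph_arc_bound[OF G12(1), of S] planar_graph_arc_bound[OF G12(2), of S] G12(3,4) assms(2,3)
    by simp
qed

text \<open>A strongly connected component lies in the set reachable from any one of its vertices,
  and \<open>clustered\<close> bounds that set.\<close>

lemma has_clusteringI:
  assumes G: "pair_graph G" and c: "clustered (parcs G) (pverts G) f c"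
  shows "has_clustering G f c"
  unfolding has_clustering_def monochromatic_components_def
proof
  let ?H = "with_proj (monochromatic_subgraph G f)"
  let ?M = "mono_rel (parcs G) (pverts G) f"
  fix K assume "K \<in> pre_digraph.sccs ?H"
  then have K: "induced_subgraph K ?H" "strongly_connected K" by (auto elim: pre_digraph.in_sccsE)
  then have s: "subgraph K ?H" by (simp add: induced_subgraph_def)
  have "arcs_ends K \<subseteq> arcs_ends ?H"
    using s by (auto simp: subgraph_def compatible_def arcs_ends_def arc_to_ends_def)
  also have "arcs_ends ?H = ?M"
    using pair_graphD(2)[OF G] by (auto simp: monochromatic_subgraph_def mono_rel_def)
  finally have sub: "(arcs_ends K)\<^sup>* \<subseteq> ?M\<^sup>*" by (rule rtrancl_mono)
  have VK: "verts K \<subseteq> pverts G"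
    using s by (auto simp: subgraph_def monochromatic_subgraph_def)
  obtain v where v: "v \<in> verts K" using K(2) by (auto simp: strongly_connected_def)
  have "(v, u) \<in> ?M\<^sup>*" if "u \<in> verts K" for u
  proof -
    have "v \<rightarrow>\<^sup>*\<^bsub>K\<^esub> u" using K(2) v that by (simp add: strongly_connected_def)
    then show ?thesis using subsetD[OF sub] reachable_rtranclI by metis
  qed
  then have "verts K \<subseteq> ?M\<^sup>* `` {v}" by blast
  moreover have "finite (?M\<^sup>* `` {v})"
  proof (rule finite_subset)
    show "?M\<^sup>* `` {v} \<subseteq> pverts G"
      using v VK by (auto elim: rtranclE simp: mono_rel_def)
  qed (rule pair_graphD(1)[OF G])
  ultimately have "card (verts K) \<le> card (?M\<^sup>* `` {v})" by (rule card_mono[rotated])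
  also have "\<dots> \<le> c" using c v VK by (auto simp: clustered_def)
  finally show "card (verts K) \<le> c" .
qed

text \<open>The numerical condition turns average degree below 12 into the sparsity demanded by the
  reduction. It holds with equality for \<open>a = 4\<close>, \<open>k = 9\<close> and for
  \<open>a = 3\<close>, \<open>k = 8\<close>.\<close>

lemma choosable_with_clusteringI:
  fixes G :: "'a pair_pre_digraph" and a :: int
  assumes G: "earth_moon_graph G" and a: "a \<ge> 2" "12 * (a - 1) \<le> a * int k"
    and ext: "\<And>A (L :: 'a \<Rightarrow> 'c set). list_graph A (parcs G \<inter> A \<times> A) L \<Longrightarrow> \<forall>v\<in>A. card (L v) \<le> k \<Longrightarrow>
        slack a A (parcs G \<inter> A \<times> A) L \<Longrightarrow>
        \<exists>h. (\<forall>v\<in>A. h v \<in> L v) \<and> clustered (parcs G \<inter> A \<times> A) A h c"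
  shows "choosable_with_clustering TYPE('c) G k c"
  unfolding choosable_with_clustering_def
proof (intro allI impI)
  fix L :: "'a \<Rightarrow> 'c set" assume L: "list_assignment k G L"
  have pg: "pair_graph G" using G by (simp add: earth_moon_graph_def)
  note pgD = pair_graphD[OF pg]
  have sparse: "(a - 1) * int (\<Sum>v\<in>S. card (parcs G `` {v} \<inter> S)) < a * int k * int (card S)"
    if S: "S \<subseteq> pverts G" "S \<noteq> {}" for S
  proof -
    have "(a - 1) * int (\<Sum>v\<in>S. card (parcs G `` {v} \<inter> S)) < (a - 1) * (12 * int (card S))"
      using earth_moon_degree_sum[OF G S] a(1) by (intro mult_strict_left_mono) linarith+
    also have "\<dots> = 12 * (a - 1) * int (card S)" by simp
    also have "\<dots> \<le> a * int k * int (card S)" using a(2) by (intro mult_right_mono) auto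
    finally show ?thesis .
  qed
  have "\<exists>f. (\<forall>v\<in>pverts G. f v \<in> L v) \<and> clustered (parcs G) (pverts G) f c"
    by (rule choosable_if_sparse[OF pgD(1,3,4) a(1) sparse ext])
      (use L in \<open>auto simp: list_assignment_def\<close>)
  then show "\<exists>f. list_colouring G L f \<and> has_clustering G f c"
    using has_clusteringI[OF pg] by (auto simp: list_colouring_def)
qed

theorem theorem22:
  fixes G :: "'a pair_pre_digraph"
  assumes "earth_moon_graph G"
  shows "choosable_with_clustering TYPE('c) G 9 2 \<and>
         choosable_with_clustering TYPE('c) G 8 405"
proof
  show "choosable_with_clustering TYPE('c) G 9 2"
  proof (rule choosable_with_clusteringI[OF assms, of 4])
    fix A and L :: "'a \<Rightarrow> 'c set"
    assume "list_graph A (parcs G \<inter> A \<times> A) L" "slack 4 A (parcs G \<inter> A \<times> A) L"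
    then show "\<exists>h. (\<forall>v\<in>A. h v \<in> L v) \<and> clustered (parcs G \<inter> A \<times> A) A h 2"
      by (rule list_graph.clustered_2)
  qed simp_all
  show "choosable_with_clustering TYPE('c) G 8 405"
  proof (rule choosable_with_clusteringI[OF assms, of 3])
    fix A and L :: "'a \<Rightarrow> 'c set"
    assume "list_graph A (parcs G \<inter> A \<times> A) L" "\<forall>v\<in>A. card (L v) \<le> 8" "slack 3 A (parcs G \<inter> A \<times> A) L"
    then have "slack3_graph A (parcs G \<inter> A \<times> A) L"
      by (simp add: slack3_graph_def slack3_graph_axioms_def)
    then show "\<exists>h. (\<forall>v\<in>A. h v \<in> L v) \<and> clustered (parcs G \<inter> A \<times> A) A h 405"
      by (rule slack3_graph.clustered_405)
  qed simp_all
qed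

end
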